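(* For any $d, N \in \mathbb{N}$ (positive integers) we have $$D^*(N,d) \leq 2.4631832 \sqrt{\frac{d}{N}},$$ and hence, for $\varepsilon > 0$, $$N^*(\varepsilon,d) \leq 6.0672715\, d\, \varepsilon^{-2}.$$
   Context: For a point set $P = \{x_1,\ldots,x_N\} \subset [0,1]^d$ with $N$ elements, the star-discrepancy is $$D_N^*(P) := \sup_{B} \left| \frac{\#\{1 \leq n \leq N : x_n \in B\}}{N} - \lambda_d(B) \right|,$$ where $\lambda_d$ is $d$-dimensional Lebesgue measure and the supremum is over all boxes $B = [0,b_1) \times \cdots \times [0,b_d)$ with $0 \leq b_i \leq 1$ for $i = 1,\ldots,d$. The $N$-th minimal star-discrepancy in dimension $d$ is $$D^*(N,d) := \inf\{ D_N^*(P) : P \subset [0,1]^d,\ \#P = N \},$$ and the inverse star-discrepancy is, for $\varepsilon > 0$, $$N^*(\varepsilon,d) := \inf\{ N \in \mathbb{N} : D^*(N,d) \leq \varepsilon \}.$$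
   Formalization: The second bound is proved as N*(ε,d) ≤ max(1, 6.0672715 d ε^{-2}), since as printed it fails for large ε: N* ≥ 1 always, while for d = 1, ε = 10 the right-hand side is about 0.06. *)

theory Defs
  imports "HOL-Analysis.Analysis"
begin

text \<open>Points of \<open>\<real>\<^sup>d\<close> are extensional functions on the index set \<open>{..<d}\<close>, so that \<open>d\<close> is an
  ordinary natural number; \<open>\<lambda>\<^sub>d\<close> is the \<open>d\<close>-fold product of the one-dimensional Lebesgue measure.\<close>

definition unit_cube :: "nat \<Rightarrow> (nat \<Rightarrow> real) set" where
  "unit_cube d = {..<d} \<rightarrow>\<^sub>E {0..1}"

definition anchored_box :: "nat \<Rightarrow> (nat \<Rightarrow> real) \<Rightarrow> (nat \<Rightarrow> real) set" where
  "anchored_box d b = (\<Pi>\<^sub>E i\<in>{..<d}. {0..<b i})"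

definition lebesgue_pow :: "nat \<Rightarrow> (nat \<Rightarrow> real) measure" where
  "lebesgue_pow d = (\<Pi>\<^sub>M i\<in>{..<d}. lborel)"

definition star_discrepancy :: "nat \<Rightarrow> (nat \<Rightarrow> real) set \<Rightarrow> real" where
  "star_discrepancy d P =
     (SUP b \<in> unit_cube d.
        \<bar>real (card (P \<inter> anchored_box d b)) / real (card P)
         - measure (lebesgue_pow d) (anchored_box d b)\<bar>)"

definition min_star_discrepancy :: "nat \<Rightarrow> nat \<Rightarrow> real" where
  "min_star_discrepancy N d =
     Inf {star_discrepancy d P | P. P \<subseteq> unit_cube d \<and> finite P \<and> card P = N}"

text \<open>The value is an extended natural number so that the infimum of the empty set is \<open>\<infinity>\<close>;
  on \<^typ>\<open>nat\<close> it would be \<open>0\<close>. The number of points is positive.\<close>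

definition inverse_star_discrepancy :: "real \<Rightarrow> nat \<Rightarrow> enat" where
  "inverse_star_discrepancy \<epsilon> d =
     Inf {enat N | N. N \<ge> 1 \<and> min_star_discrepancy N d \<le> \<epsilon>}"

end

theory Submission
  imports Defs "HOL-Probability.Hoeffding"
begin

text \<open>
  Independent uniform points work with positive probability, by a chaining argument. At each of
  finitely many scales \<open>\<delta>\<^sub>0 > \<dots> > \<delta>\<^sub>K\<close> the anchored boxes are rounded to finitely many boxes, at the
  cost of a volume of at most \<open>\<delta>\<^sub>k\<close>. Rounding at all scales writes a box, up to volume \<open>\<delta>\<^sub>K\<close>, as the
  disjoint union of one of the coarsest boxes and of differences of successive boxes. The
  deviation on the coarsest boxes is bounded by Hoeffding's inequality, and on the differences, whose
  variance is at most \<open>\<delta>\<^sub>k\<close>, by Bernstein's. If \<open>exp (d * H\<^sub>k)\<close> bounds twice the number of boxes at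
  scale \<open>k\<close> and \<open>s = sqrt (d / N)\<close>, then (\<open>min_star_discrepancy_le_chaining_sum\<close>)
  \<open>D\<^sup>*(N,d) \<le> \<delta>\<^sub>K + s * sqrt (H\<^sub>0 / 2) + \<Sum>\<^bsub>k<K\<^esub> (s * sqrt (2 * \<delta>\<^sub>k * H\<^bsub>k+1\<^esub>) + s\<^sup>2 * H\<^bsub>k+1\<^esub> / 3)\<close>.

  The numerical constant owes its size to two choices. The expected maxima over the scales are
  added, instead of giving each scale a share of the failure probability
  (\<open>exists_tuple_all_sums_le\<close>). And the scales decrease fast, by a factor of \<open>128\<close>: as the number of boxes
  enters only through its logarithm, finer boxes are cheap, and the first term
  \<open>s * sqrt (H\<^sub>0 / 2)\<close> dominates. This leaves enough room for a simple bracketing by products of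
  geometric progressions, for which \<open>H = 1 + ln (ln (1 / \<delta>) / \<delta> + 2)\<close>
  (\<open>exists_bracketing_maps\<close>).

  All probability is finite: cells of an \<open>m \<times> \<dots> \<times> m\<close> grid are sampled, expectations are averages over
  \<open>N\<close>-tuples of cells, and points are put into the cells afterwards. As the number of brackets does
  not depend on \<open>m\<close>, the error \<open>d / m\<close> of the discretisation can be made arbitrarily small.

  The bound on the inverse discrepancy is about integers: with \<open>C = 6.0672715 * d / \<epsilon>\<^sup>2\<close>, rounding
  \<open>C\<close> up to the next integer would exceed \<open>C\<close>. Hence \<open>N = \<lfloor>C\<rfloor>\<close> points have to suffice, that is, the
  bound on \<open>D\<^sup>*(N,d)\<close> is needed with \<open>N + 1\<close> in place of \<open>N\<close>
  (\<open>min_star_discrepancy_le_sqrt_Suc\<close>).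
\<close>

section \<open>Exponential moments and simultaneous deviations of independent samples\<close>

text \<open>Since \<open>(n + 2)! \<ge> 2 \<cdot> 3\<^sup>n\<close>, the exponential series from its quadratic term on is dominated
  by the geometric series with first term \<open>x\<^sup>2 / 2\<close> and ratio \<open>x / 3\<close>.\<close>

lemma exp_minus_linear_le_Bernstein:
  fixes x :: real
  assumes "0 \<le> x" "x < 3"
  shows "exp x - 1 - x \<le> x\<^sup>2 / (2 * (1 - x / 3))"
proof -
  have fact_ge: "2 * 3 ^ n \<le> (fact (n + 2) :: real)" for n
  proof (induction n)
    case (Suc n)
    have "2 * 3 ^ Suc n \<le> real (n + 3) * (2 * 3 ^ n)"
      by (simp add: algebra_simps)
    also have "\<dots> \<le> real (n + 3) * fact (n + 2)"
      using Suc by (intro mult_left_mono) auto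
    finally show ?case by (simp add: algebra_simps)
  qed (simp add: fact_numeral)
  have geo: "(\<lambda>n. x\<^sup>2 / 2 * (x / 3) ^ n) sums (x\<^sup>2 / 2 * (1 / (1 - x / 3)))"
    using assms by (intro sums_mult geometric_sums) auto
  have "exp x - 1 - x = (\<Sum>n. inverse (fact (n + 2)) *\<^sub>R (x ^ (n + 2)))"
    using exp_first_two_terms[of x] by simp
  also have "\<dots> \<le> (\<Sum>n. x\<^sup>2 / 2 * (x / 3) ^ n)"
  proof (rule suminf_le)
    fix n
    have "inverse (fact (n + 2)) \<le> inverse (2 * 3 ^ n :: real)"
      using fact_ge[of n] by (intro le_imp_inverse_le) auto
    hence "inverse (fact (n + 2)) * x ^ (n + 2) \<le> inverse (2 * 3 ^ n) * x ^ (n + 2)"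
      using assms by (intro mult_right_mono) auto
    also have "\<dots> = x\<^sup>2 / 2 * (x / 3) ^ n"
      by (simp add: power_divide field_simps power2_eq_square)
    finally show "inverse (fact (n + 2)) *\<^sub>R (x ^ (n + 2)) \<le> x\<^sup>2 / 2 * (x / 3) ^ n"
      by simp
  next
    show "summable (\<lambda>n. inverse (fact (n + 2)) *\<^sub>R (x ^ (n + 2)))"
      using summable_ignore_initial_segment[OF summable_exp_generic[of x], of 2]
      by (simp add: divide_inverse)
  next
    show "summable (\<lambda>n. x\<^sup>2 / 2 * (x / 3) ^ n)"
      using geo by (rule sums_summable)
  qed
  also have "\<dots> = x\<^sup>2 / (2 * (1 - x / 3))"
    using sums_unique[OF geo] by simp
  finally show ?thesis .
qed

text \<open>This holds because \<open>(1 + x + x\<^sup>2 / 2) (1 - x + x\<^sup>2 / 2) = 1 + x\<^sup>4 / 4\<close> is at least \<open>1\<close> and the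
  first factor is at most \<open>exp x\<close>.\<close>

lemma exp_minus_le_quadratic:
  fixes x :: real
  assumes "0 \<le> x"
  shows "exp (-x) - 1 + x \<le> x\<^sup>2 / 2"
proof -
  have "1 \<le> exp x * (1 - x + x\<^sup>2 / 2)"
  proof -
    have "1 \<le> (1 + x + x\<^sup>2 / 2) * (1 - x + x\<^sup>2 / 2)"
      using assms by (simp add: algebra_simps power2_eq_square)
    also have "\<dots> \<le> exp x * (1 - x + x\<^sup>2 / 2)"
    proof (intro mult_right_mono exp_lower_Taylor_quadratic assms)
      have "0 \<le> ((x - 1)\<^sup>2 + 1) / 2" by simp
      thus "0 \<le> 1 - x + x\<^sup>2 / 2" by (simp add: power2_eq_square field_simps)
    qed
    finally show ?thesis .
  qed
  hence "exp (-x) \<le> 1 - x + x\<^sup>2 / 2"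
    by (simp add: exp_minus field_simps)
  thus ?thesis by simp
qed

text \<open>The tuple \<open>f\<close> consists of \<open>N\<close> independent uniform samples from \<open>\<Omega>\<close>. For each \<open>k\<close>, the quantity
  \<open>E k f\<close> in the proof is the sum over \<open>g \<in> \<G> k\<close> of the exponential moments
  \<open>exp (l k * \<Sum>\<^sub>n g (f n))\<close>, normalised so that its average over all tuples is at most \<open>1\<close>. Because of
  \<open>1 + y \<le> exp y\<close>, the function \<open>(a k + E k f - 1) / l k\<close> is an upper bound for
  \<open>\<Sum>\<^sub>n g (f n)\<close>, simultaneously for all \<open>g \<in> \<G> k\<close>, and has average at most \<open>a k / l k\<close>. Averages,
  unlike tail probabilities, add up over \<open>k\<close> without any loss, and some tuple is no worse than the
  average.\<close>

lemma exists_tuple_all_sums_le: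
  fixes \<G> :: "nat \<Rightarrow> ('a \<Rightarrow> real) set" and L l \<psi> :: "nat \<Rightarrow> real"
  assumes fin: "finite \<Omega>" and ne: "\<Omega> \<noteq> {}"
    and finG: "\<And>k. k \<le> K \<Longrightarrow> finite (\<G> k)"
    and card: "\<And>k. k \<le> K \<Longrightarrow> real (card (\<G> k)) \<le> exp (L k)"
    and pos: "\<And>k. k \<le> K \<Longrightarrow> l k > 0"
    and mgf: "\<And>k g. k \<le> K \<Longrightarrow> g \<in> \<G> k \<Longrightarrow>
      (\<Sum>x\<in>\<Omega>. exp (l k * g x)) \<le> real (card \<Omega>) * exp (\<psi> k)"
  shows "\<exists>f \<in> {..<N} \<rightarrow>\<^sub>E \<Omega>. \<forall>g. (\<forall>k\<le>K. g k \<in> \<G> k) \<longrightarrow>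
     (\<Sum>k\<le>K. \<Sum>n<N. g k (f n)) \<le> (\<Sum>k\<le>K. (L k + real N * \<psi> k) / l k)"
proof -
  define T where "T = {..<N} \<rightarrow>\<^sub>E \<Omega>"
  define a where "a = (\<lambda>k. L k + real N * \<psi> k)"
  define E where "E = (\<lambda>k f. \<Sum>g\<in>\<G> k. exp (l k * (\<Sum>n<N. g (f n)) - a k))"
  define W where "W = (\<lambda>f. \<Sum>k\<le>K. (a k + E k f - 1) / l k)"
  have finT: "finite T" and neT: "T \<noteq> {}"
    using fin ne by (auto simp: T_def PiE_eq_empty_iff intro: finite_PiE)
  have cardT: "real (card T) = real (card \<Omega>) ^ N"
    by (simp add: T_def card_PiE)
  have E_avg: "(\<Sum>f\<in>T. E k f) \<le> real (card T)" if k: "k \<le> K" for k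
  proof -
    \<comment> \<open>independence: the exponential moment of the sum is the product of those of the summands\<close>
    have one: "(\<Sum>f\<in>T. exp (l k * (\<Sum>n<N. g (f n)) - a k)) \<le> real (card T) * exp (- L k)"
      if g: "g \<in> \<G> k" for g
    proof -
      have "(\<Sum>f\<in>T. exp (l k * (\<Sum>n<N. g (f n)) - a k))
          = (\<Sum>f\<in>T. \<Prod>n<N. exp (l k * g (f n))) * exp (- a k)"
        by (simp add: exp_diff exp_minus divide_inverse sum_distrib_left exp_sum
              flip: sum_distrib_right)
      also have "(\<Sum>f\<in>T. \<Prod>n<N. exp (l k * g (f n))) = (\<Prod>n<N. \<Sum>x\<in>\<Omega>. exp (l k * g x))"
        unfolding T_def using fin by (subst prod_sum_PiE) auto
      also have "\<dots> = (\<Sum>x\<in>\<Omega>. exp (l k * g x)) ^ N" by simp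
      also have "\<dots> * exp (- a k) \<le> (real (card \<Omega>) * exp (\<psi> k)) ^ N * exp (- a k)"
        using mgf[OF k g] by (intro mult_right_mono power_mono) (auto intro: sum_nonneg)
      also have "\<dots> = real (card T) * exp (- L k)"
        by (simp add: power_mult_distrib cardT a_def exp_of_nat_mult[symmetric] exp_add[symmetric])
      finally show ?thesis .
    qed
    have "(\<Sum>f\<in>T. E k f) = (\<Sum>g\<in>\<G> k. \<Sum>f\<in>T. exp (l k * (\<Sum>n<N. g (f n)) - a k))"
      unfolding E_def by (rule sum.swap)
    also have "\<dots> \<le> (\<Sum>g\<in>\<G> k. real (card T) * exp (- L k))"
      by (intro sum_mono one)
    also have "\<dots> = real (card (\<G> k)) * exp (- L k) * real (card T)" by simp
    also have "\<dots> \<le> exp (L k) * exp (- L k) * real (card T)"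
      using card[OF k] by (intro mult_right_mono) auto
    finally show ?thesis by (simp add: exp_minus)
  qed
  have "(\<Sum>f\<in>T. W f) = (\<Sum>k\<le>K. \<Sum>f\<in>T. (a k + E k f - 1) / l k)"
    unfolding W_def by (rule sum.swap)
  also have "\<dots> = (\<Sum>k\<le>K. (card T * (a k - 1) + (\<Sum>f\<in>T. E k f)) / l k)"
    by (intro sum.cong refl) (simp add: sum.distrib sum_subtractf algebra_simps flip: sum_divide_distrib)
  also have "\<dots> \<le> (\<Sum>k\<le>K. real (card T) * a k / l k)"
    using E_avg pos by (intro sum_mono divide_right_mono) (auto simp: algebra_simps less_imp_le)
  also have "\<dots> = (\<Sum>f\<in>T. \<Sum>k\<le>K. a k / l k)"
    by (simp add: sum_distrib_left)
  finally have "(\<Sum>f\<in>T. W f) \<le> (\<Sum>f\<in>T. \<Sum>k\<le>K. a k / l k)" .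
  then obtain f where f: "f \<in> T" "W f \<le> (\<Sum>k\<le>K. a k / l k)"
    using sum_strict_mono[OF finT neT, of "\<lambda>_. \<Sum>k\<le>K. a k / l k" W] by (force simp: not_le)
  have "(\<Sum>k\<le>K. \<Sum>n<N. g k (f n)) \<le> (\<Sum>k\<le>K. a k / l k)" if g: "\<forall>k\<le>K. g k \<in> \<G> k" for g
  proof -
    have "(\<Sum>k\<le>K. \<Sum>n<N. g k (f n)) \<le> W f"
      unfolding W_def
    proof (intro sum_mono)
      fix k assume "k \<in> {..K}"
      hence k: "k \<le> K" by simp
      define y where "y = l k * (\<Sum>n<N. g k (f n)) - a k"
      have "y \<le> exp y - 1" using exp_ge_add_one_self[of y] by linarith
      also have "exp y \<le> E k f"
        unfolding E_def y_def
        by (rule member_le_sum[where f = "\<lambda>g. exp (l k * (\<Sum>n<N. g (f n)) - a k)"])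
           (use g k finG in auto)
      finally have "l k * (\<Sum>n<N. g k (f n)) \<le> a k + E k f - 1" by (simp add: y_def)
      thus "(\<Sum>n<N. g k (f n)) \<le> (a k + E k f - 1) / l k"
        using pos[OF k] by (simp add: field_simps)
    qed
    with f show ?thesis by simp
  qed
  thus ?thesis using f(1) unfolding a_def T_def by blast
qed

lemma sum_exp_centered_indicator:
  fixes A \<Omega> :: "'a set" and l :: real
  assumes "finite \<Omega>" "\<Omega> \<noteq> {}" "A \<subseteq> \<Omega>"
  defines "p \<equiv> real (card A) / real (card \<Omega>)"
  shows "(\<Sum>x\<in>\<Omega>. exp (l * (indicator A x - p))) =
     real (card \<Omega>) * ((1 + p * (exp l - 1)) * exp (- l * p))"
proof -
  have c: "real (card \<Omega>) > 0" using assms by (simp add: card_gt_0_iff)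
  have "exp (l * (indicator A x - p)) = (1 + indicator A x * (exp l - 1)) * exp (- l * p)" for x
    by (cases "x \<in> A") (simp_all add: algebra_simps flip: exp_add)
  hence 1: "(\<Sum>x\<in>\<Omega>. exp (l * (indicator A x - p))) =
     (\<Sum>x\<in>\<Omega>. 1 + indicator A x * (exp l - 1)) * exp (- l * p)"
    by (simp add: sum_distrib_right)
  have "(\<Sum>x\<in>\<Omega>. indicat_real A x) = card A"
    using assms by (simp add: indicator_def sum.If_cases Int_absorb1)
  hence "(\<Sum>x\<in>\<Omega>. 1 + indicator A x * (exp l - 1)) = card \<Omega> + card A * (exp l - 1)"
    by (simp add: sum.distrib flip: sum_distrib_right)
  also have "\<dots> = real (card \<Omega>) * (1 + p * (exp l - 1))"
    using c by (simp add: p_def field_simps)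
  finally show ?thesis by (simp add: 1)
qed

text \<open>For \<open>\<sigma> = -1\<close> one passes to the complement of \<open>A\<close>, whose centred indicator is the negative of
  that of \<open>A\<close>; so Hoeffding's lemma for Bernoulli variables covers both signs.\<close>

lemma sum_exp_centered_indicator_le_Hoeffding:
  fixes A \<Omega> :: "'a set" and l :: real
  assumes "finite \<Omega>" "\<Omega> \<noteq> {}" "A \<subseteq> \<Omega>" "l \<ge> 0" "\<sigma> = 1 \<or> \<sigma> = -1"
  defines "p \<equiv> real (card A) / real (card \<Omega>)"
  shows "(\<Sum>x\<in>\<Omega>. exp (l * (\<sigma> * (indicator A x - p)))) \<le> real (card \<Omega>) * exp (l\<^sup>2 / 8)"
proof -
  have plus: "(\<Sum>x\<in>\<Omega>. exp (l * (indicator B x - q))) \<le> real (card \<Omega>) * exp (l\<^sup>2 / 8)"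
    if B: "B \<subseteq> \<Omega>" and q: "q = real (card B) / real (card \<Omega>)" for B q
  proof -
    have "0 \<le> q" by (simp add: q)
    moreover have "0 < 1 + q * (exp l - 1)"
      using \<open>0 \<le> q\<close> \<open>l \<ge> 0\<close> by (intro add_pos_nonneg mult_nonneg_nonneg) auto
    ultimately have "ln (1 + q * (exp l - 1)) + (- l * q) \<le> l\<^sup>2 / 8"
      using Hoeffdings_lemma_aux[OF \<open>l \<ge> 0\<close>, of q] by simp
    hence "exp (ln (1 + q * (exp l - 1)) + (- l * q)) \<le> exp (l\<^sup>2 / 8)"
      by (simp only: exp_le_cancel_iff)
    hence "(1 + q * (exp l - 1)) * exp (- l * q) \<le> exp (l\<^sup>2 / 8)"
      by (simp only: exp_add exp_ln[OF \<open>0 < 1 + q * (exp l - 1)\<close>])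
    thus ?thesis
      using sum_exp_centered_indicator[OF assms(1,2) B, of l]
      by (simp add: q mult_left_mono)
  qed
  from assms(5) show ?thesis
  proof
    assume "\<sigma> = 1"
    thus ?thesis using plus[OF assms(3) p_def[THEN meta_eq_to_obj_eq]] by simp
  next
    assume s: "\<sigma> = -1"
    have c: "real (card \<Omega>) > 0" using assms by (simp add: card_gt_0_iff)
    have "card (\<Omega> - A) = card \<Omega> - card A" "card A \<le> card \<Omega>"
      using assms by (auto simp: card_Diff_subset finite_subset card_mono)
    hence q: "1 - p = real (card (\<Omega> - A)) / real (card \<Omega>)"
      using c by (simp add: p_def field_simps of_nat_diff)
    have "(\<Sum>x\<in>\<Omega>. exp (l * (\<sigma> * (indicator A x - p)))) =
        (\<Sum>x\<in>\<Omega>. exp (l * (indicator (\<Omega> - A) x - (1 - p))))"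
      by (intro sum.cong refl arg_cong[where f = exp]) (auto simp: s indicator_def)
    also have "\<dots> \<le> real (card \<Omega>) * exp (l\<^sup>2 / 8)"
      by (rule plus[OF _ q]) auto
    finally show ?thesis .
  qed
qed

text \<open>By \<open>1 + x \<le> exp x\<close> the exponential moment is at most that of a centred Poisson variable, and this
  one is bounded by the second-order estimates above. A set of small measure thus has small
  exponential moments, which Hoeffding's lemma does not see.\<close>

lemma sum_exp_centered_indicator_le_Bernstein:
  fixes A \<Omega> :: "'a set" and l :: real
  assumes "finite \<Omega>" "\<Omega> \<noteq> {}" "A \<subseteq> \<Omega>" "0 \<le> l" "l < 3" "\<sigma> = 1 \<or> \<sigma> = -1"
  defines "p \<equiv> real (card A) / real (card \<Omega>)"
  assumes "p \<le> \<delta>"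
  shows "(\<Sum>x\<in>\<Omega>. exp (l * (\<sigma> * (indicator A x - p))))
    \<le> real (card \<Omega>) * exp (\<delta> * (l\<^sup>2 / (2 * (1 - l / 3))))"
proof -
  have p0: "0 \<le> p" by (simp add: p_def)
  have main: "exp (\<sigma> * l) - 1 - \<sigma> * l \<le> l\<^sup>2 / (2 * (1 - l / 3))"
    using assms(6)
  proof
    assume "\<sigma> = 1"
    thus ?thesis using exp_minus_linear_le_Bernstein[of l] assms by simp
  next
    assume "\<sigma> = -1"
    hence "exp (\<sigma> * l) - 1 - \<sigma> * l \<le> l\<^sup>2 / 2"
      using exp_minus_le_quadratic[of l] assms by simp
    also have "\<dots> \<le> l\<^sup>2 / (2 * (1 - l / 3))"
      using assms by (intro divide_left_mono) auto
    finally show ?thesis .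
  qed
  have "(\<Sum>x\<in>\<Omega>. exp (l * (\<sigma> * (indicator A x - p)))) =
      real (card \<Omega>) * ((1 + p * (exp (\<sigma> * l) - 1)) * exp (- (\<sigma> * l) * p))"
    using sum_exp_centered_indicator[OF assms(1-3), of "\<sigma> * l"]
    by (simp add: p_def mult_ac)
  also have "\<dots> \<le> real (card \<Omega>) * (exp (p * (exp (\<sigma> * l) - 1)) * exp (- (\<sigma> * l) * p))"
    by (intro mult_left_mono mult_right_mono exp_ge_add_one_self) auto
  also have "\<dots> = real (card \<Omega>) * exp (p * (exp (\<sigma> * l) - 1 - \<sigma> * l))"
    by (simp add: algebra_simps flip: exp_add)
  also have "p * (exp (\<sigma> * l) - 1 - \<sigma> * l) \<le> \<delta> * (l\<^sup>2 / (2 * (1 - l / 3)))"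
    using main assms p0 by (intro order.trans[OF mult_left_mono[OF main p0]] mult_right_mono) auto
  finally show ?thesis by (simp add: mult_left_mono)
qed

text \<open>The minimum over \<open>l\<close> of the bound for the expected maximum, when each summand has the
  sub-Gaussian exponent \<open>l\<^sup>2 / 8\<close> and there are at most \<open>exp L\<close> sums.\<close>

lemma Hoeffding_rate:
  fixes N L :: real
  assumes "N > 0" "L > 0"
  shows "\<exists>l>0. (L + N * (l\<^sup>2 / 8)) / l = sqrt (N * L / 2)"
proof (intro exI conjI)
  define r where "r = sqrt (N * L / 2)"
  have r: "r > 0" "r\<^sup>2 = N * L / 2" using assms by (auto simp: r_def)
  show "4 * r / N > 0" using r assms by simp
  have "N * ((4 * r / N)\<^sup>2 / 8) = L"
    using assms r(2) by (simp add: power_divide power_mult_distrib field_simps power2_eq_square)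
  hence "(L + N * ((4 * r / N)\<^sup>2 / 8)) / (4 * r / N) = N * L / (2 * r)"
    using assms by (simp add: field_simps)
  also have "\<dots> = r" using r by (simp add: field_simps power2_eq_square)
  finally show "(L + N * ((4 * r / N)\<^sup>2 / 8)) / (4 * r / N) = sqrt (N * L / 2)" by (simp add: r_def)
qed

text \<open>The same minimisation for the Bernstein exponent, where \<open>v\<close> bounds the variance of the sums. The
  witness \<open>l\<close> solves \<open>1 / l = 1 / 3 + sqrt (v / (2 * L))\<close>.\<close>

lemma Bernstein_rate:
  fixes v L :: real
  assumes "v > 0" "L > 0"
  shows "\<exists>l>0. l < 3 \<and> (L + v * (l\<^sup>2 / (2 * (1 - l / 3)))) / l = sqrt (2 * v * L) + L / 3"
proof (intro exI conjI)
  define r where "r = sqrt (2 * v * L)"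
  have r: "r > 0" "r\<^sup>2 = 2 * v * L" using assms by (auto simp: r_def)
  define D where "D = 2 * L + 3 * r"
  define l where "l = 6 * L / D"
  have d: "D > 0" using assms r by (simp add: D_def)
  show l: "l > 0" using assms d by (simp add: l_def)
  show "l < 3" using assms r d by (simp add: l_def divide_less_eq) (simp add: D_def)
  have e: "1 - l / 3 = 3 * r / D"
    using d by (simp add: l_def divide_simps) (simp add: D_def)
  have "v * (l\<^sup>2 / (2 * (1 - l / 3))) / l = v * l / (2 * (1 - l / 3))"
    using l by (simp add: power2_eq_square)
  also have "\<dots> = v * L / r" unfolding e using d r(1) by (simp add: l_def field_simps)
  also have "\<dots> = r / 2" using r by (simp add: field_simps power2_eq_square)
  finally have 1: "v * (l\<^sup>2 / (2 * (1 - l / 3))) / l = r / 2" .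
  have 2: "L / l = L / 3 + r / 2"
    using assms d by (simp add: l_def divide_simps) (simp add: D_def algebra_simps)
  show "(L + v * (l\<^sup>2 / (2 * (1 - l / 3)))) / l = sqrt (2 * v * L) + L / 3"
    unfolding add_divide_distrib 1 2 by (simp add: r_def)
qed

section \<open>Bracketing of anchored boxes\<close>

text \<open>The terms with indices \<open>d - 1\<close> and \<open>d\<close> of the series of \<open>exp d\<close> are both \<open>d ^ d / d!\<close>. The factor
  \<open>2\<close> gained here pays for the two signs of the deviation, so that the entropy below needs no
  correction term of order \<open>1 / d\<close>.\<close>

lemma double_self_power_over_fact_le_exp:
  assumes "d \<ge> 1"
  shows "2 * real d ^ d / fact d \<le> exp (real d)"
proof -
  obtain e where d: "d = Suc e" using assms by (cases d) auto
  have "(\<Sum>n\<in>{e, Suc e}. real d ^ n /\<^sub>R fact n) \<le> (\<Sum>n. real d ^ n /\<^sub>R fact n)"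
    by (intro sum_le_suminf summable_exp_generic) auto
  hence "real d ^ e / fact e + real d ^ d / fact d \<le> exp (real d)"
    by (simp add: exp_def d divide_inverse mult_ac)
  moreover have "real d ^ e / fact e = real d ^ d / fact d"
  proof -
    have "real d ^ d = real d * real d ^ e" "(fact d :: real) = real d * fact e"
      using d by (metis power_Suc, metis fact_Suc)
    thus ?thesis using assms by simp
  qed
  ultimately show ?thesis by simp
qed

lemma exists_reduction_to_sum:
  fixes j :: "'a \<Rightarrow> nat"
  assumes "finite A"
  shows "\<exists>j'. (\<forall>i\<in>A. j' i \<le> j i) \<and> sum j' A = min (sum j A) M"
  using assms
proof (induction A rule: finite_induct)
  case (insert x A)
  then obtain j' where j': "\<forall>i\<in>A. j' i \<le> j i" "sum j' A = min (sum j A) M" by blast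
  define j'' where "j'' = j'(x := min (j x) (M - sum j' A))"
  have "sum j'' A = sum j' A"
    using insert.hyps by (intro sum.cong) (auto simp: j''_def)
  hence "sum j'' (insert x A) = min (sum j (insert x A)) M"
    using insert.hyps j'(2) by (simp add: j''_def[THEN fun_cong, of x] del: fun_upd_apply) (auto simp: min_def)
  moreover have "\<forall>i\<in>insert x A. j'' i \<le> j i"
    using j'(1) by (auto simp: j''_def)
  ultimately show ?case by blast
qed auto

text \<open>A bound, after division by \<open>d\<close>, for the logarithm of twice the number of brackets of width
  \<open>\<delta>\<close> in dimension \<open>d\<close>; see \<open>exists_bracketing_maps\<close>.\<close>

definition bracketing_entropy :: "real \<Rightarrow> real" where
  "bracketing_entropy \<delta> = 1 + ln (ln (1 / \<delta>) / \<delta> + 2)"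

text \<open>A vector \<open>z\<close> of natural numbers at most \<open>m\<close> stands for the anchored box with upper corner
  \<open>z / m\<close>. All boxes of the chaining argument have this form.\<close>

definition grid_volume :: "nat \<Rightarrow> nat \<Rightarrow> (nat \<Rightarrow> nat) \<Rightarrow> real" where
  "grid_volume d m z = (\<Prod>i<d. real (z i) / real m)"

text \<open>The lists encode the exponent vectors \<open>j \<in> \<nat>\<^sup>d\<close> of sum at most \<open>M\<close>: the last entry is the slack
  \<open>M - \<Sum>j\<close>. Their number is a binomial coefficient, at most \<open>(M + d) ^ d / d!\<close>.\<close>

lemma card_bounded_exponents_le:
  assumes d: "d \<ge> 1" and \<delta>: "0 < \<delta>" "\<delta> < 1"
    and M: "real M \<le> real d * (ln (1 / \<delta>) / \<delta>) + 1"
  shows "2 * real (card {l :: nat list. length l = Suc d \<and> sum_list l = M})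
    \<le> exp (real d * bracketing_entropy \<delta>)"
proof -
  define X where "X = ln (1 / \<delta>) / \<delta>"
  have X: "X > 0" using \<delta> by (simp add: X_def)
  have "card {l :: nat list. length l = Suc d \<and> sum_list l = M} = (M + d) choose d"
    by (simp add: card_length_sum_list binomial_symmetric[of M "M + d"])
  hence "2 * real (card {l :: nat list. length l = Suc d \<and> sum_list l = M})
      = 2 * real (((M + d) choose d) * fact d) / fact d" by simp
  also have "\<dots> \<le> 2 * real ((M + d) ^ d) / fact d"
    by (intro divide_right_mono mult_left_mono of_nat_mono binomial_fact_pow) auto
  also have "real ((M + d) ^ d) \<le> (real d * (X + 2)) ^ d"
  proof -
    have "real (M + d) \<le> real d * X + 1 + real d" using M by (simp add: X_def)
    also have "\<dots> \<le> real d * (X + 2)" using d by (simp add: algebra_simps)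
    finally show ?thesis by (simp add: power_mono)
  qed
  also have "2 * (real d * (X + 2)) ^ d / fact d = (2 * real d ^ d / fact d) * (X + 2) ^ d"
    by (simp add: power_mult_distrib)
  also have "\<dots> \<le> exp (real d) * (X + 2) ^ d"
    using X by (intro mult_right_mono double_self_power_over_fact_le_exp d) auto
  also have "(X + 2) ^ d = exp (real d * ln (X + 2))"
    using X by (simp add: exp_of_nat_mult)
  also have "exp (real d) * \<dots> = exp (real d * bracketing_entropy \<delta>)"
    by (simp add: bracketing_entropy_def X_def algebra_simps flip: exp_add)
  finally show ?thesis by (simp add: divide_right_mono)
qed

text \<open>Each coordinate is rounded to the geometric grid \<open>1, r, r\<^sup>2, \<dots>\<close> with \<open>r ^ d = 1 - \<delta>\<close>. Rounding all
  coordinates down by one step multiplies the volume by \<open>1 - \<delta>\<close>, hence changes it by at most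
  \<open>\<delta>\<close>. The upper corner with exponents \<open>j\<close> has volume \<open>r ^ \<Sum>j\<close>, so only exponents of sum at most
  \<open>M\<close> matter, where \<open>r ^ M \<le> \<delta>\<close>: a box with a larger sum of exponents is enclosed in one with sum
  exactly \<open>M\<close>, whose volume is so small that the empty box serves as the lower bracket. The number
  of brackets does not depend on the resolution \<open>m\<close>.\<close>

lemma exists_bracketing_maps:
  fixes \<delta> :: real and d m :: nat
  assumes d: "d \<ge> 1" and m: "m \<ge> 1" and \<delta>: "0 < \<delta>" "\<delta> < 1"
  defines "G \<equiv> {..<d} \<rightarrow>\<^sub>E {..m}"
  shows "\<exists>lo up. (\<forall>z\<in>G. lo z \<in> G \<and> up z \<in> G \<and> (\<forall>i<d. lo z i \<le> z i \<and> z i \<le> up z i) \<and>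
             grid_volume d m (up z) - grid_volume d m (lo z) \<le> \<delta>) \<and>
           2 * real (card (lo ` G)) \<le> exp (real d * bracketing_entropy \<delta>) \<and>
           2 * real (card (up ` G)) \<le> exp (real d * bracketing_entropy \<delta>)"
proof -
  define r where "r = root d (1 - \<delta>)"
  have r: "0 < r" "r < 1" "r ^ d = 1 - \<delta>"
    using d \<delta> by (auto simp: r_def)
  define M where "M = nat \<lceil>real d * (ln (1 / \<delta>) / \<delta>)\<rceil>"
  have X: "0 < real d * (ln (1 / \<delta>) / \<delta>)" using d \<delta> by simp
  have M_le: "real M \<le> real d * (ln (1 / \<delta>) / \<delta>) + 1"
    and M_ge: "real d * (ln (1 / \<delta>) / \<delta>) \<le> real M"
    using X by (simp_all add: M_def)
  have rM: "r ^ M \<le> \<delta>"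
  proof -
    have "real d * ln r = ln (1 - \<delta>)" using r by (metis ln_realpow)
    also have "\<dots> \<le> - \<delta>" using ln_le_minus_one[of "1 - \<delta>"] \<delta> by simp
    finally have ln_r: "ln r \<le> - \<delta> / real d" using d by (simp add: field_simps)
    have "ln (r ^ M) = real M * ln r" using r by (simp add: ln_realpow)
    also have "\<dots> \<le> real M * (- \<delta> / real d)" by (intro mult_left_mono ln_r) auto
    also have "\<dots> \<le> - ln (1 / \<delta>)" using M_ge \<delta> d by (simp add: field_simps)
    also have "\<dots> = ln \<delta>" using \<delta> by (simp add: ln_div)
    finally show ?thesis using r \<delta> by (simp only: ln_le_cancel_iff zero_less_power)
  qed
  define Keys where "Keys = {l :: nat list. length l = Suc d \<and> sum_list l = M}"
  define UP where "UP = (\<lambda>l::nat list. \<lambda>i\<in>{..<d}. nat \<lfloor>real m * r ^ (l ! i)\<rfloor>)"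
  define LO where "LO = (\<lambda>l::nat list. \<lambda>i\<in>{..<d}.
    if (\<Sum>i<d. l ! i) = M then 0 else nat \<lceil>real m * r ^ (l ! i + 1)\<rceil>)"
  have "Keys \<subseteq> {l. set l \<subseteq> {..M} \<and> length l = Suc d}"
    by (auto simp: Keys_def intro: member_le_sum_list)
  hence finK: "finite Keys" by (rule finite_subset) (simp add: finite_lists_length_eq)
  have pow_le: "real m * r ^ k \<le> real m" for k
    using r by (simp add: mult_left_le power_le_one)
  have pow_lt: "real m * r ^ k < real m + 1" for k
    using pow_le[of k] by simp
  have UP_G: "UP l \<in> G" for l
    using pow_lt by (auto simp: UP_def G_def nat_le_iff floor_le_iff)
  have LO_G: "LO l \<in> G" for l
    using pow_le by (auto simp: LO_def G_def nat_le_iff ceiling_le_iff simp del: power_Suc)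
  have "\<exists>l\<in>Keys. (\<forall>i<d. LO l i \<le> z i \<and> z i \<le> UP l i) \<and>
      grid_volume d m (UP l) - grid_volume d m (LO l) \<le> \<delta>" if z: "z \<in> G" for z
  proof -
    define S where "S = (\<lambda>i. {k. k \<le> M \<and> real (z i) \<le> real m * r ^ k})"
    \<comment> \<open>the largest exponent, capped at \<open>M\<close>, for which the rounded coordinate is still at least \<open>z i\<close>\<close>
    define j where "j = (\<lambda>i. Max (S i))"
    have S: "finite (S i)" "0 \<in> S i" if "i < d" for i
      using z that by (auto simp: S_def G_def PiE_iff)
    have jS: "j i \<in> S i" if "i < d" for i
      unfolding j_def using S[OF that] by (intro Max_in) auto
    have j_next: "real m * r ^ (j i + 1) < real (z i)" if "i < d" "j i < M" for i
    proof (rule ccontr)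
      assume "\<not> real m * r ^ (j i + 1) < real (z i)"
      hence "j i + 1 \<in> S i" using that by (simp add: S_def)
      hence "j i + 1 \<le> j i" unfolding j_def using S[OF that(1)] by (intro Max_ge) auto
      thus False by simp
    qed
    \<comment> \<open>if the sum of the exponents exceeds \<open>M\<close>, smaller exponents (a larger box) of sum \<open>M\<close> are used\<close>
    obtain j' where j': "\<forall>i\<in>{..<d}. j' i \<le> j i" "sum j' {..<d} = min (sum j {..<d}) M"
      using exists_reduction_to_sum[of "{..<d}" j M] by auto
    define l where "l = map j' [0..<d] @ [M - sum j' {..<d}]"
    have nth: "l ! i = j' i" if "i < d" for i using that by (simp add: l_def nth_append)
    have sum_l: "(\<Sum>i<d. l ! i) = sum j' {..<d}" by (intro sum.cong) (auto simp: nth)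
    have "sum_list l = sum j' {..<d} + (M - sum j' {..<d})"
      by (simp add: l_def sum_list_distinct_conv_sum_set atLeast_upt lessThan_atLeast0)
    hence lK: "l \<in> Keys" using j'(2) by (simp add: Keys_def l_def)
    have upper: "z i \<le> UP l i" if "i < d" for i
    proof -
      have "real (z i) \<le> real m * r ^ j i" using jS[OF that] by (simp add: S_def)
      also have "\<dots> \<le> real m * r ^ j' i"
        using j'(1) that r by (intro mult_left_mono power_decreasing) auto
      finally show ?thesis using that by (simp add: UP_def nth le_nat_floor)
    qed
    have "grid_volume d m (UP l) \<le> (\<Prod>i<d. r ^ j' i)"
      unfolding grid_volume_def
    proof (intro prod_mono conjI)
      fix i assume i: "i \<in> {..<d}"
      have "real (nat \<lfloor>real m * r ^ j' i\<rfloor>) \<le> real m * r ^ j' i"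
        using r by (intro of_nat_floor) auto
      thus "real (UP l i) / real m \<le> r ^ j' i"
        using i m by (simp add: UP_def nth divide_le_eq mult_ac)
    qed simp
    also have "\<dots> = r ^ sum j' {..<d}" by (simp add: power_sum)
    finally have vol_up: "grid_volume d m (UP l) \<le> r ^ sum j' {..<d}" .
    show ?thesis
    proof (cases "sum j' {..<d} = M")
      case True
      have lo: "LO l i = 0" if "i < d" for i using that True by (simp add: LO_def sum_l)
      have "grid_volume d m (LO l) \<ge> 0" by (simp add: grid_volume_def prod_nonneg)
      hence "grid_volume d m (UP l) - grid_volume d m (LO l) \<le> \<delta>"
        using vol_up rM True by simp
      thus ?thesis using lK upper lo by (intro bexI[of _ l]) auto
    next
      case False
      hence lt: "sum j {..<d} < M" and eq: "sum j' {..<d} = sum j {..<d}" using j'(2) by auto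
      have j_eq: "j' i = j i" if "i < d" for i
      proof (rule ccontr)
        assume "j' i \<noteq> j i"
        hence "sum j' {..<d} < sum j {..<d}"
          using j'(1) that by (intro sum_strict_mono_ex1) (auto intro!: bexI[of _ i] simp: le_neq_implies_less)
        with eq show False by simp
      qed
      have LO_l: "LO l i = nat \<lceil>real m * r ^ (j i + 1)\<rceil>" if "i < d" for i
        using that False by (simp add: LO_def sum_l nth j_eq)
      have lower: "LO l i \<le> z i" if "i < d" for i
      proof -
        have "j i \<le> sum j {..<d}" using that by (intro member_le_sum) auto
        thus ?thesis using j_next[OF that] lt by (simp add: LO_l[OF that] nat_le_iff ceiling_le_iff)
      qed
      have "(1 - \<delta>) * r ^ sum j' {..<d} = (\<Prod>i<d. r ^ (j i + 1))"
        using r(3) eq by (simp add: power_sum prod.distrib)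
      also have "\<dots> \<le> grid_volume d m (LO l)"
        unfolding grid_volume_def
      proof (intro prod_mono conjI)
        fix i assume i: "i \<in> {..<d}"
        have "real m * r ^ (j i + 1) \<le> real (nat \<lceil>real m * r ^ (j i + 1)\<rceil>)"
          by (rule real_nat_ceiling_ge)
        thus "r ^ (j i + 1) \<le> real (LO l i) / real m"
          using i m by (simp add: LO_l le_divide_eq mult_ac)
      qed (use r in simp)
      finally have "grid_volume d m (UP l) - grid_volume d m (LO l) \<le> \<delta> * r ^ sum j' {..<d}"
        using vol_up by (simp add: algebra_simps)
      also have "\<dots> \<le> \<delta>" using \<delta> r by (simp add: mult_left_le power_le_one)
      finally show ?thesis using lK upper lower by (intro bexI[of _ l]) auto
    qed
  qed
  then obtain key where key: "\<And>z. z \<in> G \<Longrightarrow> key z \<in> Keys \<and>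
      (\<forall>i<d. LO (key z) i \<le> z i \<and> z i \<le> UP (key z) i) \<and>
      grid_volume d m (UP (key z)) - grid_volume d m (LO (key z)) \<le> \<delta>"
    by metis
  have count: "2 * real (card ((\<lambda>z. h (key z)) ` G)) \<le> exp (real d * bracketing_entropy \<delta>)"
    for h :: "nat list \<Rightarrow> nat \<Rightarrow> nat"
  proof -
    have "card ((\<lambda>z. h (key z)) ` G) \<le> card (h ` Keys)"
      using key finK by (intro card_mono) auto
    also have "\<dots> \<le> card Keys" by (rule card_image_le[OF finK])
    finally show ?thesis
      using card_bounded_exponents_le[OF d \<delta> M_le] by (simp add: Keys_def)
  qed
  show ?thesis
    by (rule exI[of _ "\<lambda>z. LO (key z)"], rule exI[of _ "\<lambda>z. UP (key z)"])
       (use key LO_G UP_G count in auto)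
qed

section \<open>Chaining\<close>

definition grid_box :: "nat \<Rightarrow> (nat \<Rightarrow> nat) \<Rightarrow> (nat \<Rightarrow> nat) set" where
  "grid_box d b = (\<Pi>\<^sub>E i\<in>{..<d}. {..<b i})"

lemma finite_grid_box [simp]: "finite (grid_box d b)"
  by (simp add: grid_box_def finite_PiE)

lemma grid_box_mono: "(\<And>i. i < d \<Longrightarrow> a i \<le> b i) \<Longrightarrow> grid_box d a \<subseteq> grid_box d b"
  unfolding grid_box_def by (intro PiE_mono) auto

lemma grid_volume_mono:
  "(\<And>i. i < d \<Longrightarrow> a i \<le> b i) \<Longrightarrow> grid_volume d m a \<le> grid_volume d m b"
  unfolding grid_volume_def by (intro prod_mono conjI divide_right_mono) auto

lemma card_grid_box_ratio:
  "real (card (grid_box d b)) / real (card ({..<d} \<rightarrow>\<^sub>E {..<m::nat})) = grid_volume d m b"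
  by (simp add: grid_box_def grid_volume_def card_PiE prod_dividef)

lemma bracketing_entropy_pos:
  assumes "0 < \<delta>" "\<delta> < 1" shows "bracketing_entropy \<delta> > 0"
proof -
  have "ln (1 / \<delta>) / \<delta> > 0" using assms by simp
  hence "ln (ln (1 / \<delta>) / \<delta> + 2) > 0" by (intro ln_gt_zero) simp
  thus ?thesis by (simp add: bracketing_entropy_def)
qed

text \<open>The chaining argument. A box is rounded at the finest scale \<open>K\<close> and the result is rounded down
  successively at the scales \<open>K - 1, \<dots>, 0\<close>. The deviation of the box rounded at scale \<open>K\<close> is the sum
  of the deviations of the coarsest box, which Hoeffding's bound controls, and of the differences of
  successive boxes; these have volume at most \<open>\<delta> k\<close>, so that Bernstein's bound controls them. The
  difference at scale \<open>Suc k\<close> is determined by the finer of its two boxes, so there are only as many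
  of them as there are brackets at this scale.

  An excess of points is bounded by that in the upper bracket at scale \<open>K\<close>, a deficit by that in the
  lower bracket, at the price of \<open>\<delta> K\<close>. As each sign needs only one of the two kinds of brackets,
  the number of signed sets at each scale is at most twice the number of brackets.\<close>

lemma exists_low_discrepancy_cells:
  fixes \<delta> :: "nat \<Rightarrow> real" and d m N K :: nat
  assumes d: "d \<ge> 1" and m: "m \<ge> 1" and N: "N \<ge> 1"
    and \<delta>: "\<And>k. k \<le> K \<Longrightarrow> 0 < \<delta> k \<and> \<delta> k < 1"
  defines "s \<equiv> sqrt (real d / real N)" and "H \<equiv> \<lambda>k. bracketing_entropy (\<delta> k)"
  shows "\<exists>f \<in> {..<N} \<rightarrow>\<^sub>E ({..<d} \<rightarrow>\<^sub>E {..<m}). \<forall>z \<in> {..<d} \<rightarrow>\<^sub>E {..m}.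
    \<bar>real (card {n. n < N \<and> f n \<in> grid_box d z}) / real N - grid_volume d m z\<bar>
      \<le> \<delta> K + s * sqrt (H 0 / 2)
        + (\<Sum>k<K. s * sqrt (2 * \<delta> k * H (Suc k)) + s\<^sup>2 * H (Suc k) / 3)"
proof -
  define \<Omega> :: "(nat \<Rightarrow> nat) set" where "\<Omega> = {..<d} \<rightarrow>\<^sub>E {..<m}"
  define G :: "(nat \<Rightarrow> nat) set" where "G = {..<d} \<rightarrow>\<^sub>E {..m}"
  have fin: "finite \<Omega>" "\<Omega> \<noteq> {}" "finite G"
    using m by (auto simp: \<Omega>_def G_def PiE_eq_empty_iff lessThan_empty_iff intro: finite_PiE)
  have box_sub: "grid_box d u \<subseteq> \<Omega>" if "u \<in> G" for u
    unfolding grid_box_def \<Omega>_def using that by (intro PiE_mono) (auto simp: G_def PiE_iff)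
  have ratio: "real (card (grid_box d u)) / real (card \<Omega>) = grid_volume d m u" for u
    by (simp add: \<Omega>_def card_grid_box_ratio)
  have H_pos: "H k > 0" if "k \<le> K" for k
    using \<delta>[OF that] by (simp add: H_def bracketing_entropy_pos)

  define brackets where "brackets = (\<lambda>k lo up.
      (\<forall>z\<in>G. lo z \<in> G \<and> up z \<in> G \<and> (\<forall>i<d. lo z i \<le> z i \<and> z i \<le> up z i) \<and>
         grid_volume d m (up z) - grid_volume d m (lo z) \<le> \<delta> k) \<and>
      2 * real (card (lo ` G)) \<le> exp (real d * H k) \<and>
      2 * real (card (up ` G)) \<le> exp (real d * H k))"
  have "\<exists>lo up. brackets k lo up" if "k \<le> K" for k
    using exists_bracketing_maps[OF d m, of "\<delta> k"] \<delta>[OF that]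
    unfolding brackets_def G_def H_def by simp
  then obtain lo up where bracket: "\<And>k. k \<le> K \<Longrightarrow> brackets k (lo k) (up k)"
    by metis
  have lo_G: "lo k z \<in> G" and up_G: "up k z \<in> G"
    and lo_le: "\<And>i. i < d \<Longrightarrow> lo k z i \<le> z i" and up_ge: "\<And>i. i < d \<Longrightarrow> z i \<le> up k z i"
    and gap: "grid_volume d m (up k z) - grid_volume d m (lo k z) \<le> \<delta> k"
    if "k \<le> K" "z \<in> G" for k z
    using bracket[OF that(1)] that(2) by (auto simp: brackets_def)

  \<comment> \<open>the corners used at scale \<open>k\<close> for the sign \<open>\<sigma>\<close> of the deviation\<close>
  define apx where "apx = (\<lambda>\<sigma> k. if k = K \<and> \<sigma> = (1::real) then up k else lo k)"
  have apx_G: "apx \<sigma> k z \<in> G" if "k \<le> K" "z \<in> G" for \<sigma> k z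
    using lo_G up_G that by (auto simp: apx_def)
  define part where "part = (\<lambda>k u. if k = 0 then grid_box d u else grid_box d u - grid_box d (lo (k - 1) u))"
  define cen where "cen = (\<lambda>(A :: (nat \<Rightarrow> nat) set) x. indicat_real A x - real (card A) / real (card \<Omega>))"
  define \<G> where "\<G> = (\<lambda>k. \<Union>\<sigma>\<in>{1, -1}. (\<lambda>u x. \<sigma> * cen (part k u) x) ` (apx \<sigma> k ` G))"
  define B where "B = (\<lambda>k. if k = 0 then sqrt (real N * (real d * H k) / 2)
     else sqrt (2 * (real N * \<delta> (k - 1)) * (real d * H k)) + real d * H k / 3)"
  have part_sub: "part k u \<subseteq> \<Omega>" if "u \<in> G" for k u
    using box_sub[OF that] by (auto simp: part_def)
  have cen_diff: "cen (part (Suc k) u) x = cen (grid_box d u) x - cen (grid_box d (lo k u)) x"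
    and part_small: "real (card (part (Suc k) u)) / real (card \<Omega>) \<le> \<delta> k"
    if k: "k \<le> K" and u: "u \<in> G" for k u x
  proof -
    have sub: "grid_box d (lo k u) \<subseteq> grid_box d u"
      by (intro grid_box_mono lo_le[OF k u])
    hence "real (card (part (Suc k) u)) = real (card (grid_box d u)) - real (card (grid_box d (lo k u)))"
      by (simp add: part_def card_Diff_subset card_mono of_nat_diff)
    hence eq: "real (card (part (Suc k) u)) / real (card \<Omega>) = grid_volume d m u - grid_volume d m (lo k u)"
      by (simp add: diff_divide_distrib ratio)
    show "cen (part (Suc k) u) x = cen (grid_box d u) x - cen (grid_box d (lo k u)) x"
      using sub by (simp add: cen_def eq ratio) (auto simp: part_def indicator_def)
    have "grid_volume d m u \<le> grid_volume d m (up k u)"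
      by (intro grid_volume_mono up_ge[OF k u])
    thus "real (card (part (Suc k) u)) / real (card \<Omega>) \<le> \<delta> k"
      using gap[OF k u] by (simp add: eq)
  qed

  have fin_\<G>: "finite (\<G> k)" for k using fin by (simp add: \<G>_def)
  have card_\<G>: "real (card (\<G> k)) \<le> exp (real d * H k)" if k: "k \<le> K" for k
  proof -
    have half: "2 * real (card ((\<lambda>u x. \<sigma> * cen (part k u) x) ` (apx \<sigma> k ` G))) \<le> exp (real d * H k)" for \<sigma>
    proof -
      have "card ((\<lambda>u x. \<sigma> * cen (part k u) x) ` (apx \<sigma> k ` G)) \<le> card (apx \<sigma> k ` G)"
        using fin by (intro card_image_le) auto
      moreover have "2 * real (card (apx \<sigma> k ` G)) \<le> exp (real d * H k)"
        using bracket[OF k] by (auto simp: brackets_def apx_def)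
      ultimately show ?thesis by linarith
    qed
    have "card (\<G> k) \<le> card ((\<lambda>u x. 1 * cen (part k u) x) ` (apx 1 k ` G))
        + card ((\<lambda>u x. - 1 * cen (part k u) x) ` (apx (- 1) k ` G))"
      unfolding \<G>_def using card_Un_le by simp
    thus ?thesis using half[of 1] half[of "-1"] by linarith
  qed

  have "\<exists>l \<psi>. k \<le> K \<longrightarrow> l > 0 \<and> (real d * H k + real N * \<psi>) / l = B k \<and>
      (\<forall>g\<in>\<G> k. (\<Sum>x\<in>\<Omega>. exp (l * g x)) \<le> real (card \<Omega>) * exp \<psi>)" for k
  proof (cases "k \<le> K")
    case k: True
    have L: "real d * H k > 0" using H_pos[OF k] d by simp
    have g: "\<exists>\<sigma> u. (\<sigma> = 1 \<or> \<sigma> = -1) \<and> u \<in> G \<and> g = (\<lambda>x. \<sigma> * cen (part k u) x)" if "g \<in> \<G> k" for g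
    proof -
      have "\<exists>\<sigma>\<in>{1, -1}. g \<in> (\<lambda>u x. \<sigma> * cen (part k u) x) ` (apx \<sigma> k ` G)"
        using that by (simp only: \<G>_def UN_iff)
      then obtain \<sigma> where \<sigma>: "\<sigma> \<in> {1, -1}"
        and "g \<in> (\<lambda>u x. \<sigma> * cen (part k u) x) ` (apx \<sigma> k ` G)" by (rule bexE)
      from this(2) obtain u where u: "g = (\<lambda>x. \<sigma> * cen (part k u) x)" "u \<in> apx \<sigma> k ` G" by (rule imageE)
      from u(2) obtain w where "u = apx \<sigma> k w" "w \<in> G" by (rule imageE)
      hence "u \<in> G" using apx_G[OF k] by simp
      with \<sigma> u(1) show ?thesis by (intro exI[of _ \<sigma>] exI[of _ u]) auto
    qed
    show ?thesis
    proof (cases k)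
      case 0
      obtain l where l: "l > 0" "(real d * H k + real N * (l\<^sup>2 / 8)) / l = sqrt (real N * (real d * H k) / 2)"
        using Hoeffding_rate[of "real N" "real d * H k"] L N by auto
      have "(\<Sum>x\<in>\<Omega>. exp (l * g x)) \<le> real (card \<Omega>) * exp (l\<^sup>2 / 8)" if "g \<in> \<G> k" for g
        using g[OF that] sum_exp_centered_indicator_le_Hoeffding[OF fin(1,2) part_sub, of _ l _ k] l(1)
        by (auto simp: cen_def)
      with l 0 show ?thesis
        by (intro exI[of _ l] exI[of _ "l\<^sup>2 / 8"]) (auto simp: B_def)
    next
      case (Suc k')
      have v: "real N * \<delta> k' > 0" using \<delta>[of k'] N k Suc by simp
      obtain l where l: "l > 0" "l < 3" "(real d * H k + real N * \<delta> k' * (l\<^sup>2 / (2 * (1 - l / 3)))) / l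
           = sqrt (2 * (real N * \<delta> k') * (real d * H k)) + real d * H k / 3"
        using Bernstein_rate[OF v L] by auto
      have "(\<Sum>x\<in>\<Omega>. exp (l * g x)) \<le> real (card \<Omega>) * exp (\<delta> k' * (l\<^sup>2 / (2 * (1 - l / 3))))"
        if gk: "g \<in> \<G> k" for g
      proof -
        obtain \<sigma> u where gu: "\<sigma> = 1 \<or> \<sigma> = -1" "u \<in> G" "g = (\<lambda>x. \<sigma> * cen (part k u) x)"
          using g[OF gk] by blast
        have "real (card (part k u)) / real (card \<Omega>) \<le> \<delta> k'"
          using part_small[of k' u] gu k Suc by simp
        thus ?thesis
          using sum_exp_centered_indicator_le_Bernstein[OF fin(1,2) part_sub[OF gu(2)] _ l(2) gu(1)] l(1) gu(3)
          by (auto simp: cen_def)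
      qed
      with l Suc show ?thesis
        by (intro exI[of _ l] exI[of _ "\<delta> k' * (l\<^sup>2 / (2 * (1 - l / 3)))"]) (auto simp: B_def mult.assoc)
    qed
  qed auto
  then obtain l \<psi> where rate: "\<And>k. k \<le> K \<Longrightarrow> l k > 0 \<and> (real d * H k + real N * \<psi> k) / l k = B k \<and>
      (\<forall>g\<in>\<G> k. (\<Sum>x\<in>\<Omega>. exp (l k * g x)) \<le> real (card \<Omega>) * exp (\<psi> k))"
    by metis
  obtain f where f: "f \<in> {..<N} \<rightarrow>\<^sub>E \<Omega>"
    and f_le: "\<And>g. (\<And>k. k \<le> K \<Longrightarrow> g k \<in> \<G> k) \<Longrightarrow> (\<Sum>k\<le>K. \<Sum>n<N. g k (f n)) \<le> (\<Sum>k\<le>K. B k)"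
  proof -
    have "\<exists>f \<in> {..<N} \<rightarrow>\<^sub>E \<Omega>. \<forall>g. (\<forall>k\<le>K. g k \<in> \<G> k) \<longrightarrow>
       (\<Sum>k\<le>K. \<Sum>n<N. g k (f n)) \<le> (\<Sum>k\<le>K. (real d * H k + real N * \<psi> k) / l k)"
      by (rule exists_tuple_all_sums_le) (use fin fin_\<G> card_\<G> rate in auto)
    moreover have "(\<Sum>k\<le>K. (real d * H k + real N * \<psi> k) / l k) = (\<Sum>k\<le>K. B k)"
      using rate by (intro sum.cong) auto
    ultimately show ?thesis using that by auto
  qed

  define dev where "dev = (\<lambda>u. \<Sum>n<N. cen (grid_box d u) (f n))"
  have dev_eq: "dev u = real (card {n. n < N \<and> f n \<in> grid_box d u}) - real N * grid_volume d m u" for u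
  proof -
    have "(\<Sum>n<N. indicat_real (grid_box d u) (f n)) = real (card ({..<N} \<inter> {n. f n \<in> grid_box d u}))"
      by (simp add: indicator_def sum.If_cases)
    also have "{..<N} \<inter> {n. f n \<in> grid_box d u} = {n. n < N \<and> f n \<in> grid_box d u}" by auto
    finally show ?thesis by (simp add: dev_def cen_def sum_subtractf ratio)
  qed
  have chain: "\<sigma> * dev (apx \<sigma> K z) \<le> (\<Sum>k\<le>K. B k)" if z: "z \<in> G" and \<sigma>: "\<sigma> = 1 \<or> \<sigma> = -1" for \<sigma> z
  proof -
    \<comment> \<open>the successive roundings of \<open>z\<close>, from scale \<open>K\<close> downwards; \<open>c k\<close> is the one at scale \<open>k\<close>\<close>
    define path where "path = rec_nat (apx \<sigma> K z) (\<lambda>i u. lo (K - Suc i) u)"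
    define c where "c = (\<lambda>k. path (K - k))"
    have cK: "c K = apx \<sigma> K z" by (simp add: c_def path_def)
    have c_step: "c k = lo k (c (Suc k))" if "k < K" for k
    proof -
      have "K - k = Suc (K - Suc k)" using that by simp
      thus ?thesis using that by (simp add: c_def path_def)
    qed
    have c_G: "c k \<in> G" if "k \<le> K" for k
      using that by (induction rule: inc_induct) (auto simp: cK c_step apx_G z lo_G)
    have c_apx: "c k \<in> apx \<sigma> k ` G" if "k \<le> K" for k
    proof (cases "k = K")
      case False
      thus ?thesis using that c_step[of k] c_G[of "Suc k"] by (auto simp: apx_def)
    qed (use cK z in auto)
    have tele: "(\<Sum>k\<le>j. cen (part k (c k)) x) = cen (grid_box d (c j)) x" if "j \<le> K" for j x
      using that
    proof (induction j)
      case (Suc j)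
      thus ?case using cen_diff[of j "c (Suc j)" x] c_step[of j] c_G[of "Suc j"] by simp
    qed (simp add: part_def)
    have "\<sigma> * dev (apx \<sigma> K z) = (\<Sum>n<N. \<sigma> * (\<Sum>k\<le>K. cen (part k (c k)) (f n)))"
      by (simp add: dev_def tele cK sum_distrib_left)
    also have "\<dots> = (\<Sum>k\<le>K. \<Sum>n<N. \<sigma> * cen (part k (c k)) (f n))"
      by (simp add: sum_distrib_left sum.swap[of _ "{..<N}"])
    also have "\<dots> \<le> (\<Sum>k\<le>K. B k)"
      using \<sigma> c_apx by (intro f_le) (auto simp: \<G>_def)
    finally show ?thesis .
  qed

  have B_sum: "(\<Sum>k\<le>K. B k) / real N = s * sqrt (H 0 / 2)
        + (\<Sum>k<K. s * sqrt (2 * \<delta> k * H (Suc k)) + s\<^sup>2 * H (Suc k) / 3)"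
  proof -
    have scale: "sqrt (real N * real d * y) / real N = s * sqrt y" for y
    proof -
      have "real N * real d * y / (real N)\<^sup>2 = real d / real N * y"
        using N by (simp add: power2_eq_square)
      hence "sqrt (real N * real d * y / (real N)\<^sup>2) = s * sqrt y"
        by (simp only: s_def real_sqrt_mult)
      thus ?thesis by (simp add: real_sqrt_divide)
    qed
    have "B 0 / real N = s * sqrt (H 0 / 2)"
      using scale[of "H 0 / 2"] by (simp add: B_def mult_ac)
    moreover have "B (Suc k) / real N = s * sqrt (2 * \<delta> k * H (Suc k)) + s\<^sup>2 * H (Suc k) / 3" for k
      using scale[of "2 * \<delta> k * H (Suc k)"] by (simp add: B_def mult_ac add_divide_distrib s_def)
    ultimately show ?thesis
      by (simp add: sum.atMost_shift add_divide_distrib sum_divide_distrib del: sum.atMost_Suc)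
  qed

  have "\<bar>real (card {n. n < N \<and> f n \<in> grid_box d z}) / real N - grid_volume d m z\<bar>
      \<le> \<delta> K + (\<Sum>k\<le>K. B k) / real N" if z: "z \<in> G" for z
  proof -
    have cnt: "real (card {n. n < N \<and> f n \<in> grid_box d a}) \<le> real (card {n. n < N \<and> f n \<in> grid_box d b})"
      if "\<And>i. i < d \<Longrightarrow> a i \<le> b i" for a b
      using grid_box_mono[of d a b] that by (intro of_nat_mono card_mono) auto
    note lz = lo_le[OF order.refl z] and uz = up_ge[OF order.refl z]
    have vol: "grid_volume d m (lo K z) \<le> grid_volume d m z" "grid_volume d m z \<le> grid_volume d m (up K z)"
      by (intro grid_volume_mono lz uz; assumption)+
    have "real N * grid_volume d m (up K z) \<le> real N * (grid_volume d m z + \<delta> K)"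
      "real N * (grid_volume d m z - \<delta> K) \<le> real N * grid_volume d m (lo K z)"
      using gap[OF order.refl z] vol by (intro mult_left_mono; simp)+
    hence "\<bar>real (card {n. n < N \<and> f n \<in> grid_box d z}) - real N * grid_volume d m z\<bar>
        \<le> real N * \<delta> K + (\<Sum>k\<le>K. B k)"
      using chain[OF z, of 1] chain[OF z, of "-1"] cnt[of "lo K z" z, OF lz] cnt[of z "up K z", OF uz]
      by (simp add: apx_def dev_eq algebra_simps abs_le_iff)
    hence "\<bar>real (card {n. n < N \<and> f n \<in> grid_box d z}) - real N * grid_volume d m z\<bar> / real N
        \<le> (real N * \<delta> K + (\<Sum>k\<le>K. B k)) / real N"
      by (intro divide_right_mono) auto
    moreover have "real (card {n. n < N \<and> f n \<in> grid_box d z}) / real N - grid_volume d m z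
        = (real (card {n. n < N \<and> f n \<in> grid_box d z}) - real N * grid_volume d m z) / real N"
      using N by (simp add: diff_divide_distrib)
    hence "\<bar>real (card {n. n < N \<and> f n \<in> grid_box d z}) / real N - grid_volume d m z\<bar>
        = \<bar>real (card {n. n < N \<and> f n \<in> grid_box d z}) - real N * grid_volume d m z\<bar> / real N"
      by (simp only: abs_divide abs_of_nat)
    ultimately show ?thesis using N by (simp add: add_divide_distrib)
  qed
  thus ?thesis using f unfolding B_sum \<Omega>_def G_def by (auto simp: add.assoc)
qed

section \<open>From grid cells to point sets\<close>

lemma measure_anchored_box:
  assumes "b \<in> unit_cube d"
  shows "measure (lebesgue_pow d) (anchored_box d b) = (\<Prod>i<d. b i)"
proof -
  interpret product_sigma_finite "\<lambda>_ :: nat. lborel :: real measure" by standard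
  have "emeasure (lebesgue_pow d) (anchored_box d b) = (\<Prod>i<d. emeasure lborel {0..<b i})"
    unfolding lebesgue_pow_def anchored_box_def by (rule emeasure_PiM) auto
  also have "\<dots> = (\<Prod>i<d. ennreal (b i))"
    using assms by (intro prod.cong refl) (auto simp: unit_cube_def PiE_iff)
  also have "\<dots> = ennreal (\<Prod>i<d. b i)"
    using assms by (intro prod_ennreal) (auto simp: unit_cube_def PiE_iff)
  finally have "measure (lebesgue_pow d) (anchored_box d b) = enn2real (ennreal (\<Prod>i<d. b i))"
    by (simp add: measure_def)
  moreover have "0 \<le> (\<Prod>i<d. b i)"
    using assms by (intro prod_nonneg) (auto simp: unit_cube_def PiE_iff)
  ultimately show ?thesis by simp
qed

lemma prod_unit_cube_bounds:
  assumes "b \<in> unit_cube d"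
  shows "0 \<le> (\<Prod>i<d. b i)" "(\<Prod>i<d. b i) \<le> 1"
  using assms by (auto simp: unit_cube_def PiE_iff intro!: prod_nonneg prod_le_1)

lemma local_discrepancy_le_1:
  assumes "finite P" "b \<in> unit_cube d"
  shows "\<bar>real (card (P \<inter> anchored_box d b)) / real (card P)
     - measure (lebesgue_pow d) (anchored_box d b)\<bar> \<le> 1"
proof -
  have "card (P \<inter> anchored_box d b) \<le> card P" using assms by (intro card_mono) auto
  hence "real (card (P \<inter> anchored_box d b)) / real (card P) \<le> 1"
    by (simp add: divide_le_eq)
  moreover have "0 \<le> real (card (P \<inter> anchored_box d b)) / real (card P)" by simp
  ultimately show ?thesis
    using prod_unit_cube_bounds[OF assms(2)] by (simp only: measure_anchored_box[OF assms(2)] abs_le_iff) linarith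
qed

lemma unit_cube_not_empty: "unit_cube d \<noteq> {}"
  by (simp add: unit_cube_def PiE_eq_empty_iff)

lemma star_discrepancy_nonneg:
  assumes "finite P"
  shows "0 \<le> star_discrepancy d P"
proof -
  obtain b where b: "b \<in> unit_cube d" using unit_cube_not_empty by blast
  have "bdd_above ((\<lambda>b. \<bar>real (card (P \<inter> anchored_box d b)) / real (card P)
     - measure (lebesgue_pow d) (anchored_box d b)\<bar>) ` unit_cube d)"
    using local_discrepancy_le_1[OF assms] by (intro bdd_aboveI[of _ 1]) auto
  from cSUP_upper[OF b this] show ?thesis
    unfolding star_discrepancy_def by (rule order.trans[OF abs_ge_zero])
qed

lemma min_star_discrepancy_le:
  assumes "P \<subseteq> unit_cube d" "finite P" "card P = N"
    and "\<And>b. b \<in> unit_cube d \<Longrightarrow> \<bar>real (card (P \<inter> anchored_box d b)) / real N - (\<Prod>i<d. b i)\<bar> \<le> c"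
  shows "min_star_discrepancy N d \<le> c"
proof -
  have "min_star_discrepancy N d \<le> star_discrepancy d P"
    unfolding min_star_discrepancy_def
    using assms star_discrepancy_nonneg by (intro cInf_lower bdd_belowI[of _ 0]) auto
  also have "\<dots> \<le> c"
    unfolding star_discrepancy_def
    using assms unit_cube_not_empty by (intro cSUP_least) (auto simp: measure_anchored_box)
  finally show ?thesis .
qed

text \<open>Passage from cells to points. A point is put into each chosen cell, the \<open>n\<close>-th one at relative
  position \<open>n / N\<close> along the diagonal of its cell, which makes the points distinct even if cells
  repeat. A point lies in a box with corner on the grid exactly when its cell does, and an arbitrary
  box lies between two grid boxes whose volumes differ from its own by at most \<open>d / m\<close>.\<close>

lemma min_star_discrepancy_le_cells:
  assumes d: "d \<ge> 1" and m: "m \<ge> 1" and N: "N \<ge> 1"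
    and f: "f \<in> {..<N} \<rightarrow>\<^sub>E ({..<d} \<rightarrow>\<^sub>E {..<m})"
    and bound: "\<And>z. z \<in> {..<d} \<rightarrow>\<^sub>E {..m} \<Longrightarrow>
      \<bar>real (card {n. n < N \<and> f n \<in> grid_box d z}) / real N - grid_volume d m z\<bar> \<le> c"
  shows "min_star_discrepancy N d \<le> c + real d / real m"
proof -
  define x where "x = (\<lambda>n. \<lambda>i\<in>{..<d}. (real (f n i) + real n / real N) / real m)"
  have fr: "f n i < m" if "n < N" "i < d" for n i using f that by (auto simp: PiE_iff)
  have off: "0 \<le> real n / real N" "real n / real N < 1" if "n < N" for n
    using that by auto
  have floor_x: "\<lfloor>real (f n i) + real n / real N\<rfloor> = int (f n i)" if "n < N" for n i
    using off[OF that] by linarith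
  have inj: "inj_on x {..<N}"
  proof (rule inj_onI)
    fix n n' assume n: "n \<in> {..<N}" "n' \<in> {..<N}" and "x n = x n'"
    hence "x n 0 = x n' 0" by simp
    hence eq: "real (f n 0) + real n / real N = real (f n' 0) + real n' / real N"
      using d m by (simp add: x_def)
    hence "f n 0 = f n' 0" using floor_x[of n 0] floor_x[of n' 0] n by simp
    with eq show "n = n'" using N by simp
  qed
  have less_iff: "x n i < real z / real m \<longleftrightarrow> f n i < z" if "n < N" "i < d" for n i z
  proof -
    have "x n i < real z / real m \<longleftrightarrow> real (f n i) + real n / real N < real z"
      using that m by (simp add: x_def divide_less_cancel)
    also have "\<dots> \<longleftrightarrow> f n i < z" using off[OF that(1)] by linarith
    finally show ?thesis .
  qed
  have x_cube: "x n \<in> unit_cube d" if n: "n < N" for n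
  proof -
    have "x n i \<in> {0..1}" if i: "i < d" for i
      using less_iff[OF n i, of m] fr[OF n i] m i off[OF n] by (simp add: x_def)
    moreover have "x n \<in> extensional {..<d}" by (simp add: x_def)
    ultimately show ?thesis by (simp add: unit_cube_def PiE_iff)
  qed
  have x_box: "x n \<in> anchored_box d b \<longleftrightarrow> (\<forall>i<d. x n i < b i)" if "n < N" for n b
    using x_cube[OF that] by (auto simp: unit_cube_def anchored_box_def PiE_iff)
  have f_box: "f n \<in> grid_box d z \<longleftrightarrow> (\<forall>i<d. f n i < z i)" if "n < N" for n z
    using f that by (auto simp: grid_box_def PiE_iff)
  define P where "P = x ` {..<N}"
  have cardP: "card P = N" by (simp add: P_def card_image inj)
  show ?thesis
  proof (rule min_star_discrepancy_le[of P])
    show "P \<subseteq> unit_cube d" using x_cube by (auto simp: P_def)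
    show "finite P" by (simp add: P_def)
    show "card P = N" by fact
    fix b assume b: "b \<in> unit_cube d"
    have b01: "0 \<le> b i" "b i \<le> 1" if "i < d" for i using b that by (auto simp: unit_cube_def PiE_iff)
    define u where "u = (\<lambda>i\<in>{..<d}. nat \<lfloor>real m * b i\<rfloor>)"
    define v where "v = (\<lambda>i\<in>{..<d}. nat \<lceil>real m * b i\<rceil>)"
    have mb: "0 \<le> real m * b i" "real m * b i \<le> real m" if "i < d" for i
      using b01[OF that] by (auto simp: mult_left_le)
    have u_le: "real (u i) \<le> real m * b i" and u_gt: "real m * b i < real (u i) + 1"
      and v_ge: "real m * b i \<le> real (v i)" and v_lt: "real (v i) < real m * b i + 1"
      and u_m: "u i \<le> m" and v_m: "v i \<le> m"
      if "i < d" for i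
      using mb[OF that] that unfolding u_def v_def by (simp; linarith)+
    have G: "u \<in> {..<d} \<rightarrow>\<^sub>E {..m}" "v \<in> {..<d} \<rightarrow>\<^sub>E {..m}"
      using u_m v_m by (auto simp: PiE_iff u_def v_def)
    have div: "real (u i) / real m \<le> b i" "b i \<le> real (v i) / real m"
      "real (u i) / real m \<le> 1" "real (v i) / real m \<le> 1"
      if i: "i < d" for i
      using u_le[OF i] u_gt[OF i] v_ge[OF i] v_lt[OF i] u_m[OF i] v_m[OF i] m
      by (auto simp: field_simps)
    have near: "\<bar>b i - real (u i) / real m\<bar> \<le> 1 / real m" "\<bar>real (v i) / real m - b i\<bar> \<le> 1 / real m"
      if i: "i < d" for i
    proof -
      have "b i - real (u i) / real m = (real m * b i - real (u i)) / real m"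
        "real (v i) / real m - b i = (real (v i) - real m * b i) / real m"
        using m by (simp_all add: diff_divide_distrib)
      moreover have "\<bar>real m * b i - real (u i)\<bar> \<le> 1" "\<bar>real (v i) - real m * b i\<bar> \<le> 1"
        using u_le[OF i] u_gt[OF i] v_ge[OF i] v_lt[OF i] by linarith+
      ultimately show "\<bar>b i - real (u i) / real m\<bar> \<le> 1 / real m" "\<bar>real (v i) / real m - b i\<bar> \<le> 1 / real m"
        by (simp_all add: divide_right_mono)
    qed
    have vol_u: "(\<Prod>i<d. b i) - grid_volume d m u \<le> real d / real m"
    proof -
      have "norm ((\<Prod>i<d. b i) - (\<Prod>i<d. real (u i) / real m)) \<le> (\<Sum>i<d. norm (b i - real (u i) / real m))"
        using b01 div by (intro norm_prod_diff) auto
      also have "\<dots> \<le> (\<Sum>i<d. 1 / real m)" using near by (intro sum_mono) auto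
      finally show ?thesis by (simp add: grid_volume_def abs_le_iff)
    qed
    have vol_v: "grid_volume d m v - (\<Prod>i<d. b i) \<le> real d / real m"
    proof -
      have "norm ((\<Prod>i<d. real (v i) / real m) - (\<Prod>i<d. b i)) \<le> (\<Sum>i<d. norm (real (v i) / real m - b i))"
        using b01 div by (intro norm_prod_diff) auto
      also have "\<dots> \<le> (\<Sum>i<d. 1 / real m)" using near by (intro sum_mono) auto
      finally show ?thesis by (simp add: grid_volume_def abs_le_iff)
    qed
    have "P \<inter> anchored_box d b = x ` {n. n < N \<and> x n \<in> anchored_box d b}"
      by (auto simp: P_def)
    hence cnt: "card (P \<inter> anchored_box d b) = card {n. n < N \<and> x n \<in> anchored_box d b}"
      by (simp add: card_image inj_on_subset[OF inj] subset_eq)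
    have "{n. n < N \<and> f n \<in> grid_box d u} \<subseteq> {n. n < N \<and> x n \<in> anchored_box d b}"
    proof clarify
      fix n assume n: "n < N" "f n \<in> grid_box d u"
      have "x n i < b i" if "i < d" for i
        using n f_box[of n u] less_iff[of n i "u i"] div(1)[OF that] that by auto
      thus "x n \<in> anchored_box d b" using x_box[OF n(1)] by blast
    qed
    hence "card {n. n < N \<and> f n \<in> grid_box d u} \<le> card (P \<inter> anchored_box d b)"
      unfolding cnt by (intro card_mono) auto
    hence lower: "real (card {n. n < N \<and> f n \<in> grid_box d u}) / real N \<le> real (card (P \<inter> anchored_box d b)) / real N"
      by (simp add: divide_right_mono)
    have "{n. n < N \<and> x n \<in> anchored_box d b} \<subseteq> {n. n < N \<and> f n \<in> grid_box d v}"
    proof clarify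
      fix n assume n: "n < N" "x n \<in> anchored_box d b"
      have "f n i < v i" if "i < d" for i
        using n x_box[of n b] less_iff[of n i "v i"] div(2)[OF that] that by auto
      thus "f n \<in> grid_box d v" using f_box[OF n(1)] by blast
    qed
    hence "card (P \<inter> anchored_box d b) \<le> card {n. n < N \<and> f n \<in> grid_box d v}"
      unfolding cnt by (intro card_mono) auto
    hence upper: "real (card (P \<inter> anchored_box d b)) / real N \<le> real (card {n. n < N \<and> f n \<in> grid_box d v}) / real N"
      by (simp add: divide_right_mono)
    show "\<bar>real (card (P \<inter> anchored_box d b)) / real N - (\<Prod>i<d. b i)\<bar> \<le> c + real d / real m"
      using bound[OF G(1)] bound[OF G(2)] lower upper vol_u vol_v by (simp add: abs_le_iff)
  qed
qed

lemma min_star_discrepancy_le_1: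
  assumes "d \<ge> 1" "N \<ge> 1"
  shows "min_star_discrepancy N d \<le> 1"
proof -
  define x where "x = (\<lambda>n. \<lambda>i\<in>{..<d}. real n / real N)"
  have "inj_on x {..<N}"
  proof (rule inj_onI)
    fix n n' assume "x n = x n'"
    hence "x n 0 = x n' 0" by simp
    thus "n = n'" using assms by (simp add: x_def)
  qed
  hence "card (x ` {..<N}) = N" by (simp add: card_image)
  moreover have "x n \<in> unit_cube d" if "n < N" for n
    using that by (simp add: x_def unit_cube_def restrict_PiE_iff)
  ultimately have P: "x ` {..<N} \<subseteq> unit_cube d" "finite (x ` {..<N})" "card (x ` {..<N}) = N"
    by auto
  thus ?thesis
    using local_discrepancy_le_1[OF P(2)] by (intro min_star_discrepancy_le[OF P]) (simp add: measure_anchored_box)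
qed

text \<open>The resolution \<open>m\<close> of the grid is arbitrary, so its cost \<open>d / m\<close> disappears in the limit.\<close>

lemma min_star_discrepancy_le_chaining_sum:
  fixes \<delta> :: "nat \<Rightarrow> real" and d N K :: nat
  assumes d: "d \<ge> 1" and N: "N \<ge> 1" and \<delta>: "\<And>k. k \<le> K \<Longrightarrow> 0 < \<delta> k \<and> \<delta> k < 1"
  defines "s \<equiv> sqrt (real d / real N)" and "H \<equiv> \<lambda>k. bracketing_entropy (\<delta> k)"
  shows "min_star_discrepancy N d \<le> \<delta> K + s * sqrt (H 0 / 2)
    + (\<Sum>k<K. s * sqrt (2 * \<delta> k * H (Suc k)) + s\<^sup>2 * H (Suc k) / 3)" (is "_ \<le> ?B")
proof (rule field_le_epsilon)
  fix e :: real assume "e > 0"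
  obtain m :: nat where "real d / e < real m" using reals_Archimedean2 by blast
  moreover have "0 < real d / e" using d \<open>e > 0\<close> by simp
  ultimately have "0 < real m" by linarith
  hence m: "m \<ge> 1" "real d / real m \<le> e"
    using \<open>real d / e < real m\<close> \<open>e > 0\<close> by (auto simp: field_simps)
  obtain f where "f \<in> {..<N} \<rightarrow>\<^sub>E ({..<d} \<rightarrow>\<^sub>E {..<m})" "\<forall>z \<in> {..<d} \<rightarrow>\<^sub>E {..m}.
    \<bar>real (card {n. n < N \<and> f n \<in> grid_box d z}) / real N - grid_volume d m z\<bar> \<le> ?B"
    using exists_low_discrepancy_cells[OF d m(1) N, of K \<delta>] \<delta> unfolding s_def H_def by blast
  hence "min_star_discrepancy N d \<le> ?B + real d / real m"
    using min_star_discrepancy_le_cells[OF d m(1) N] by blast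
  with m show "min_star_discrepancy N d \<le> ?B + e" by simp
qed

section \<open>Explicit constants\<close>

text \<open>For \<open>\<delta> = 1 / 2 ^ a\<close> the entropy is essentially \<open>1 + a * ln 2 + ln (7 * a / 10)\<close>. The last logarithm
  is bounded by its tangent at \<open>2 ^ c\<close>, so all that enters is the bound \<open>25 / 36\<close> for \<open>ln 2\<close>; the
  best choice of \<open>2 ^ c\<close> is the power of two next to \<open>7 * a / 10\<close>.\<close>

lemma bracketing_entropy_dyadic_le:
  assumes "a \<ge> 6"
  shows "bracketing_entropy (1 / 2 ^ a) \<le> real (a + c) * (25 / 36) + 7 * real a / (10 * 2 ^ c)"
proof -
  have ln_pow: "ln (2 ^ n :: real) \<le> real n * (25 / 36)" for n
    using mult_left_mono[OF ln2_le_25_over_36, of "real n"] by (simp add: ln_realpow)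
  have "(2 :: real) / 2 ^ a \<le> 2 / 2 ^ 6"
    using assms by (intro divide_left_mono power_increasing) auto
  hence "(2 :: real) / 2 ^ a \<le> 1 / 32" by (simp only: power_numeral) simp
  hence "ln (2 ^ a) + 2 / 2 ^ a \<le> 7 * real a / 10"
    using ln_pow[of a] of_nat_mono[OF assms, where 'a = real] by linarith
  hence "ln (2 ^ a) * 2 ^ a + 2 \<le> 2 ^ a * (7 * real a / 10)"
    by (simp add: field_simps)
  hence "ln (ln (2 ^ a) * 2 ^ a + 2) \<le> ln (2 ^ a * (7 * real a / 10))"
    using assms by (intro ln_mono) (auto intro: add_nonneg_pos)
  also have "\<dots> = ln (2 ^ a) + ln (7 * real a / 10)"
    using assms by (intro ln_mult_pos) auto
  also have "7 * real a / 10 = 2 ^ c * (7 * real a / (10 * 2 ^ c))" by simp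
  also have "ln \<dots> = ln (2 ^ c) + ln (7 * real a / (10 * 2 ^ c))"
    using assms by (intro ln_mult_pos) auto
  also have "ln (7 * real a / (10 * 2 ^ c)) \<le> 7 * real a / (10 * 2 ^ c) - 1"
    using assms by (intro ln_le_minus_one) auto
  finally show ?thesis
    using ln_pow[of a] ln_pow[of c] by (simp add: bracketing_entropy_def algebra_simps add_divide_distrib)
qed

text \<open>Chaining with one scale only. It suffices as long as \<open>s\<close> is not too small compared with the scale
  \<open>1 / 2 ^ a\<close>.\<close>

lemma min_star_discrepancy_le_single_scale:
  assumes d: "d \<ge> 1" and N: "N \<ge> 1" and a: "a \<ge> 6"
  defines "s \<equiv> sqrt (real d / real N)"
  assumes s: "1 / 2 ^ a \<le> t * s"
    and r: "real (a + c) * (25 / 36) + 7 * real a / (10 * 2 ^ c) \<le> 2 * r\<^sup>2" "0 \<le> r"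
  shows "min_star_discrepancy N d \<le> (t + r) * s"
proof -
  have "min_star_discrepancy N d \<le> 1 / 2 ^ a + s * sqrt (bracketing_entropy (1 / 2 ^ a) / 2)"
    using min_star_discrepancy_le_chaining_sum[OF d N, of 0 "\<lambda>_. 1 / 2 ^ a"] a
    by (simp add: s_def power_gt1)
  moreover have "sqrt (bracketing_entropy (1 / 2 ^ a) / 2) \<le> r"
    using bracketing_entropy_dyadic_le[OF a, of c] r by (intro real_le_lsqrt) auto
  hence "s * sqrt (bracketing_entropy (1 / 2 ^ a) / 2) \<le> s * r"
    by (intro mult_left_mono) (auto simp: s_def)
  ultimately have "min_star_discrepancy N d \<le> t * s + s * r"
    using s by linarith
  thus ?thesis by (simp add: algebra_simps)
qed

text \<open>Chaining with the scales \<open>2 ^ -10, 2 ^ -17, 2 ^ -24, \<dots>\<close>, stopped at the first one below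
  \<open>s / 100\<close>. The entropies grow linearly along these scales while the variances decrease by the
  factor \<open>128\<close>, so the contributions decay geometrically. In units of \<open>s\<close> they are at most
  \<open>2.2255\<close> for the coarsest boxes, \<open>0.1936\<close> for the first differences, \<open>0.0268\<close> for all later ones
  and \<open>0.01\<close> for the final bracket.\<close>

lemma min_star_discrepancy_le_geometric_scales:
  assumes d: "d \<ge> 1" and N: "N \<ge> 1"
  defines "s \<equiv> sqrt (real d / real N)"
  assumes s_small: "s \<le> 0.004"
  shows "min_star_discrepancy N d \<le> 2.456 * s"
proof -
  have s: "s > 0" using d N by (simp add: s_def)
  define \<delta> :: "nat \<Rightarrow> real" where "\<delta> = (\<lambda>k. 1 / 2 ^ (10 + 7 * k))"
  define H where "H = (\<lambda>k. bracketing_entropy (\<delta> k))"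
  obtain n where n: "(1 / 2 :: real) ^ n < s / 100"
    using real_arch_pow_inv[of "s / 100" "1 / 2"] s by auto
  have "\<delta> n \<le> (1 / 2) ^ n"
    unfolding \<delta>_def power_one_over by (intro divide_left_mono power_increasing) auto
  hence ex: "\<delta> n \<le> s / 100" using n by simp
  define K where "K = (LEAST K. \<delta> K \<le> s / 100)"
  have K: "\<delta> K \<le> s / 100" unfolding K_def using ex by (rule LeastI)
  \<comment> \<open>before the last scale, \<open>s\<close> is at most a multiple of the scale; this makes the linear terms of
    Bernstein's bound, which carry the factor \<open>s\<^sup>2\<close>, summable\<close>
  have before: "s \<le> 100 * \<delta> k" if "k < K" for k
    using not_less_Least[of k "\<lambda>K. \<delta> K \<le> s / 100"] that by (simp add: K_def)
  have "K \<noteq> 0"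
  proof
    assume "K = 0"
    thus False using K s_small by (simp add: \<delta>_def)
  qed
  then obtain K' where K': "K = Suc K'" using not0_implies_Suc by blast
  define T where "T = (\<lambda>k. s * sqrt (2 * \<delta> k * H (Suc k)) + s\<^sup>2 * H (Suc k) / 3)"

  have "sqrt (H 0 / 2) \<le> 2.2255"
    using bracketing_entropy_dyadic_le[of 10 3]
    by (intro real_le_lsqrt) (simp_all add: H_def \<delta>_def power2_eq_square)
  hence first: "s * sqrt (H 0 / 2) \<le> s * (22255 / 10000)" using s by (intro mult_left_mono) auto

  have second: "T 0 \<le> s * (1936 / 10000)"
  proof -
    have H1: "H 1 \<le> 15.33"
      using bracketing_entropy_dyadic_le[of 17 4] by (simp add: H_def \<delta>_def)
    have "sqrt (2 * \<delta> 0 * H 1) \<le> 0.1731"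
      using H1 by (intro real_le_lsqrt) (simp_all add: \<delta>_def power2_eq_square)
    moreover have "s * H 1 / 3 \<le> 0.004 * 15.33 / 3"
    proof -
      have "s * H 1 \<le> s * 15.33" using H1 s by (intro mult_left_mono) auto
      also have "\<dots> \<le> 0.004 * 15.33" using s_small by (intro mult_right_mono) auto
      finally show ?thesis by simp
    qed
    ultimately have "sqrt (2 * \<delta> 0 * H 1) + s * H 1 / 3 \<le> 0.1936" by simp
    hence "s * (sqrt (2 * \<delta> 0 * H 1) + s * H 1 / 3) \<le> s * 0.1936"
      using s by (intro mult_left_mono) auto
    thus ?thesis by (simp add: T_def power2_eq_square algebra_simps)
  qed

  have later: "T (Suc j) \<le> s * 0.0234 * (1 / 8) ^ j" if j: "j < K'" for j
  proof -
    have pw: "(64 :: real) ^ j = 8 ^ j * 8 ^ j" by (simp flip: power_mult_distrib)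
    have d_eq: "\<delta> (Suc j) = 1 / (131072 * 128 ^ j)"
      by (simp add: \<delta>_def power_add power_mult)
    have growth: "real (24 + 7 * j) \<le> 24 * 2 ^ j"
      by (induction j) (auto simp: algebra_simps)
    have "H (Suc (Suc j)) \<le> real (24 + 7 * j + 4) * (25 / 36) + 7 * real (24 + 7 * j) / (10 * 2 ^ 4)"
      using bracketing_entropy_dyadic_le[of "24 + 7 * j" 4] by (simp add: H_def \<delta>_def add.commute)
    also have "\<dots> \<le> 7 / 8 * real (24 + 7 * j)"
      by (simp add: field_simps)
    also have "\<dots> \<le> 21 * 2 ^ j" using growth by simp
    finally have HH: "H (Suc (Suc j)) \<le> 21 * 2 ^ j" .
    have "\<delta> (Suc j) * H (Suc (Suc j)) \<le> \<delta> (Suc j) * (21 * 2 ^ j)"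
      using HH by (intro mult_left_mono) (auto simp: \<delta>_def)
    also have "\<dots> = 21 / 131072 * (1 / 64) ^ j"
      by (simp add: d_eq power_one_over field_simps flip: power_mult_distrib)
    finally have dH: "\<delta> (Suc j) * H (Suc (Suc j)) \<le> 21 / 131072 * (1 / 64) ^ j" .
    have "sqrt (2 * \<delta> (Suc j) * H (Suc (Suc j))) \<le> 0.018 * (1 / 8) ^ j"
    proof (rule real_le_lsqrt)
      have "(1 / 64 :: real) ^ j = ((1 / 8) ^ j)\<^sup>2"
        by (simp add: power2_eq_square flip: power_mult_distrib)
      moreover have "(0 :: real) \<le> ((1 / 8) ^ j)\<^sup>2" by simp
      moreover have square: "(0.018 * (1 / 8 :: real) ^ j)\<^sup>2 = 81 / 250000 * ((1 / 8) ^ j)\<^sup>2"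
        by (simp only: power_mult_distrib) (simp add: power2_eq_square)
      ultimately show "2 * \<delta> (Suc j) * H (Suc (Suc j)) \<le> (0.018 * (1 / 8) ^ j)\<^sup>2"
        using dH unfolding square mult.assoc[of 2] by linarith
    qed simp
    moreover have "s * H (Suc (Suc j)) / 3 \<le> 0.0054 * (1 / 8) ^ j"
    proof -
      have H0: "H (Suc (Suc j)) \<ge> 0"
        unfolding H_def by (intro less_imp_le bracketing_entropy_pos) (auto simp: \<delta>_def power_gt1)
      have "s * H (Suc (Suc j)) \<le> 100 * (\<delta> (Suc j) * H (Suc (Suc j)))"
        using mult_right_mono[OF before[of "Suc j"] H0] j K' by simp
      also have "\<dots> \<le> 2100 / 131072 * (1 / 64) ^ j" using dH by simp
      also have "\<dots> \<le> 2100 / 131072 * (1 / 8) ^ j" by (intro mult_left_mono power_mono) auto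
      also have "\<dots> \<le> 0.0162 * (1 / 8) ^ j" by (intro mult_right_mono) auto
      finally show ?thesis by simp
    qed
    ultimately have "sqrt (2 * \<delta> (Suc j) * H (Suc (Suc j))) + s * H (Suc (Suc j)) / 3 \<le> 0.0234 * (1 / 8) ^ j"
      by simp
    hence "s * (sqrt (2 * \<delta> (Suc j) * H (Suc (Suc j))) + s * H (Suc (Suc j)) / 3) \<le> s * (0.0234 * (1 / 8) ^ j)"
      using s by (intro mult_left_mono) auto
    thus ?thesis by (simp add: T_def power2_eq_square algebra_simps)
  qed

  have "(\<Sum>j<K'. T (Suc j)) \<le> (\<Sum>j<K'. s * 0.0234 * (1 / 8) ^ j)"
    by (intro sum_mono later) auto
  also have "\<dots> = s * 0.0234 * (\<Sum>j<K'. (1 / 8) ^ j)" by (simp add: sum_distrib_left)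
  also have "\<dots> \<le> s * 0.0234 * (8 / 7)"
  proof (rule mult_left_mono)
    show "(\<Sum>j<K'. (1 / 8 :: real) ^ j) \<le> 8 / 7"
      by (subst geometric_sum) (simp_all add: field_simps)
  qed (use s in simp)
  finally have tail: "(\<Sum>j<K'. T (Suc j)) \<le> s * (234 / 10000) * (8 / 7)" by simp

  have "min_star_discrepancy N d \<le> \<delta> K + s * sqrt (H 0 / 2) + (\<Sum>k<K. T k)"
    unfolding T_def H_def s_def
    by (rule min_star_discrepancy_le_chaining_sum[OF d N]) (auto simp: \<delta>_def power_gt1)
  also have "(\<Sum>k<K. T k) = T 0 + (\<Sum>j<K'. T (Suc j))"
    unfolding K' by (rule sum.lessThan_Suc_shift)
  finally have "min_star_discrepancy N d \<le> s / 100 + s * (22255 / 10000) + (s * (1936 / 10000) + s * (234 / 10000) * (8 / 7))"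
    using K first second tail by linarith
  also have "\<dots> \<le> 2.456 * s" using s by simp
  finally show ?thesis .
qed

lemma power2_mult_sqrt: "y \<ge> 0 \<Longrightarrow> (c * sqrt y)\<^sup>2 = c\<^sup>2 * y"
  by (simp add: power_mult_distrib)

lemma scaled_sqrt_le_sqrt_Suc:
  assumes "N \<ge> 1" "0 \<le> C" "C\<^sup>2 * (real N + 1) \<le> 2.4631832\<^sup>2 * real N"
  shows "C * sqrt (real d / real N) \<le> 2.4631832 * sqrt (real d / (real N + 1))"
proof (rule power2_le_imp_le)
  define y where "y = real d / real N / (real N + 1)"
  have "C\<^sup>2 * (real d / real N) = C\<^sup>2 * (real N + 1) * y"
    by (simp add: y_def add_nonneg_eq_0_iff)
  also have "\<dots> \<le> 2.4631832\<^sup>2 * real N * y"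
    using assms(3) by (intro mult_right_mono) (auto simp: y_def)
  also have "\<dots> = 2.4631832\<^sup>2 * (real d / (real N + 1))"
    using assms(1) by (simp add: y_def)
  finally show "(C * sqrt (real d / real N))\<^sup>2 \<le> (2.4631832 * sqrt (real d / (real N + 1)))\<^sup>2"
    by (simp only: power2_mult_sqrt divide_nonneg_nonneg of_nat_0_le_iff add_nonneg_nonneg zero_le_one)
qed simp

text \<open>The bound with \<open>N + 1\<close> in place of \<open>N\<close>, from which both claims follow. If \<open>N + 1 \<le> 6 * d\<close>, the right
  hand side is at least \<open>1\<close>, because \<open>2.4631832\<^sup>2 \<ge> 6\<close>. Otherwise the chaining bounds have the form
  \<open>C * s\<close> with \<open>C < 2.4631832\<close>. The gap between the two constants compensates the factor
  \<open>sqrt ((N + 1) / N)\<close>: where \<open>C\<close> is close to \<open>2.4631832\<close>, which is for small \<open>s\<close>, the number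
  \<open>N = d / s\<^sup>2\<close> is large.\<close>

lemma min_star_discrepancy_le_sqrt_Suc:
  assumes d: "d \<ge> 1" and N: "N \<ge> 1"
  shows "min_star_discrepancy N d \<le> 2.4631832 * sqrt (real d / (real N + 1))"
proof (cases "N + 1 \<le> 6 * d")
  case True
  have "1 / 6 \<le> real d / (real N + 1)" using True by (simp add: field_simps)
  hence "1 \<le> 2.4631832\<^sup>2 * (real d / (real N + 1))" by (simp add: power2_eq_square)
  hence "1\<^sup>2 \<le> (2.4631832 * sqrt (real d / (real N + 1)))\<^sup>2"
    by (subst power2_mult_sqrt) auto
  hence "1 \<le> 2.4631832 * sqrt (real d / (real N + 1))"
    by (rule power2_le_imp_le) simp
  thus ?thesis using min_star_discrepancy_le_1[OF d N] by simp
next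
  case False
  hence N6: "real N \<ge> 6" using d by simp
  define s where "s = sqrt (real d / real N)"
  have s2: "s\<^sup>2 * real N = real d" using N by (simp add: s_def)
  have many: "real N \<ge> 1 / t\<^sup>2" if "s \<le> t" "t > 0" for t
  proof -
    have "s\<^sup>2 \<le> t\<^sup>2" using that by (intro power_mono) (auto simp: s_def)
    hence "1 \<le> t\<^sup>2 * real N"
      using mult_right_mono[of "s\<^sup>2" "t\<^sup>2" "real N"] s2 d by simp
    thus ?thesis using that by (simp add: field_simps)
  qed
  \<comment> \<open>a fixed scale \<open>\<delta>\<close> costs \<open>\<delta> / s + sqrt (H / 2)\<close> in units of \<open>s\<close>: the scale \<open>2 ^ -6\<close> is fine enough
    down to \<open>s = 0.1\<close>, the scale \<open>2 ^ -11\<close> down to \<open>s = 0.004\<close>; below, several scales are needed\<close>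
  consider "s \<ge> 0.1" | "0.004 \<le> s" "s \<le> 0.1" | "s \<le> 0.004" by linarith
  thus ?thesis
  proof cases
    case 1
    have "min_star_discrepancy N d \<le> (0.1563 + 1.82) * s"
      unfolding s_def by (rule min_star_discrepancy_le_single_scale[OF d N, of 6 _ 2])
        (use 1 in \<open>auto simp: s_def power2_eq_square\<close>)
    also have "\<dots> \<le> 2.4631832 * sqrt (real d / (real N + 1))"
      unfolding s_def using N6 by (intro scaled_sqrt_le_sqrt_Suc N) (auto simp: power2_eq_square)
    finally show ?thesis .
  next
    case 2
    have "min_star_discrepancy N d \<le> (0.1221 + 2.3116) * s"
      unfolding s_def by (rule min_star_discrepancy_le_single_scale[OF d N, of 11 _ 3])
        (use 2 in \<open>auto simp: s_def power2_eq_square\<close>)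
    also have "\<dots> \<le> 2.4631832 * sqrt (real d / (real N + 1))"
      unfolding s_def using many[OF 2(2)] by (intro scaled_sqrt_le_sqrt_Suc N) (auto simp: power2_eq_square)
    finally show ?thesis .
  next
    case 3
    have "min_star_discrepancy N d \<le> 2.456 * s"
      using min_star_discrepancy_le_geometric_scales[OF d N] 3 by (simp add: s_def)
    also have "\<dots> \<le> 2.4631832 * sqrt (real d / (real N + 1))"
      unfolding s_def using many[OF 3] by (intro scaled_sqrt_le_sqrt_Suc N) (auto simp: power2_eq_square)
    finally show ?thesis .
  qed
qed

theorem theorem1:
  fixes d :: nat
  assumes "d \<ge> 1"
  shows "(\<forall>N::nat. N \<ge> 1 \<longrightarrow>
            min_star_discrepancy N d \<le> 2.4631832 * sqrt (real d / real N)) \<and>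
         (\<forall>\<epsilon>::real. \<epsilon> > 0 \<longrightarrow>
            ereal_of_enat (inverse_star_discrepancy \<epsilon> d)
              \<le> ereal (max 1 (6.0672715 * real d * \<epsilon> powi (-2))))"
proof (intro conjI allI impI)
  fix N :: nat assume N: "N \<ge> 1"
  have "min_star_discrepancy N d \<le> 2.4631832 * sqrt (real d / (real N + 1))"
    by (rule min_star_discrepancy_le_sqrt_Suc[OF assms N])
  also have "\<dots> \<le> 2.4631832 * sqrt (real d / real N)"
    using N by (intro mult_left_mono real_sqrt_le_mono divide_left_mono) auto
  finally show "min_star_discrepancy N d \<le> 2.4631832 * sqrt (real d / real N)" .
next
  fix \<epsilon> :: real assume \<epsilon>: "\<epsilon> > 0"
  \<comment> \<open>the number of points must not exceed \<open>max 1 C\<close>; rounding down gives \<open>C < N + 1\<close>, for which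
    the bound with \<open>N + 1\<close> is made\<close>
  define C where "C = 6.0672715 * real d * \<epsilon> powi (-2)"
  have C: "C * \<epsilon>\<^sup>2 = 6.0672715 * real d"
    using \<epsilon> by (simp add: C_def power_int_minus field_simps)
  define N where "N = max 1 (nat \<lfloor>C\<rfloor>)"
  have N1: "N \<ge> 1" by (simp add: N_def)
  have C_less: "C < real N + 1" unfolding N_def by linarith
  have "min_star_discrepancy N d \<le> 2.4631832 * sqrt (real d / (real N + 1))"
    by (rule min_star_discrepancy_le_sqrt_Suc[OF assms N1])
  also have "\<dots> \<le> \<epsilon>"
  proof (rule power2_le_imp_le)
    have "2.4631832\<^sup>2 * real d \<le> 6.0672715 * real d"
      by (intro mult_right_mono) (auto simp: power2_eq_square)
    also have "\<dots> \<le> (real N + 1) * \<epsilon>\<^sup>2"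
      unfolding C[symmetric] using C_less by (intro mult_right_mono) auto
    finally show "(2.4631832 * sqrt (real d / (real N + 1)))\<^sup>2 \<le> \<epsilon>\<^sup>2"
      by (subst power2_mult_sqrt) (auto simp: divide_le_eq mult_ac)
  qed (use \<epsilon> in simp)
  finally have "inverse_star_discrepancy \<epsilon> d \<le> enat N"
    unfolding inverse_star_discrepancy_def using N1 by (intro Inf_lower) auto
  hence "ereal_of_enat (inverse_star_discrepancy \<epsilon> d) \<le> ereal_of_enat (enat N)"
    by (simp only: ereal_of_enat_le_iff)
  also have "\<dots> = ereal (real N)" by simp
  also have "real N \<le> max 1 C" unfolding N_def by linarith
  finally show "ereal_of_enat (inverse_star_discrepancy \<epsilon> d)
      \<le> ereal (max 1 (6.0672715 * real d * \<epsilon> powi (-2)))"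
    by (simp add: C_def)
qed

end
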